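(* Let $g,n\ge0$. The sequence of Lie algebras $$0\to\mathfrak{u}^f_{g,12\cdots n}\xrightarrow{\iota}\mathfrak{t}^f_{g,12\cdots n*0}\xrightarrow{\varepsilon^*}\mathfrak{t}^f_{g,12\cdots n0}\to0$$ is a split short exact sequence, with splitting $\circ_0\mathrm{id}_{*0}\colon\mathfrak{t}^f_{g,12\cdots n0}\to\mathfrak{t}^f_{g,12\cdots n*0}$. In particular, $\iota$ is injective and its image is the kernel of $\varepsilon^*$.
   Context: $\mathbb{K}$ is a field of characteristic $0$. For a finite set $I$ and $g\ge0$, $\mathfrak{t}^f_{g,I}$ is the Lie algebra over $\mathbb{K}$ generated by $t_{ij}$ ($i,j\in I$) and $x^a_i,y^a_i$ ($i\in I$, $1\le a\le g$), subject to: - $t_{ij}=t_{ji}$; - $[t_{ij},t_{kl}]=0$ if $\{i,j\}\cap\{k,l\}=\varnothing$; - $[t_{ij},t_{ik}+t_{jk}]=0$ if $k\notin\{i,j\}$; - $[x^a_i,y^b_j]=\delta_{ab}t_{ij}$ and $[x^a_i,x^b_j]=[y^a_i,y^b_j]=0$ for $i\ne j$; - $[x^a_k,t_{ij}]=[y^a_k,t_{ij}]=0$ if $k\notin\{i,j\}$; - $[x^a_i+x^a_j,t_{ij}]=[y^a_i+y^a_j,t_{ij}]=0$; - for each $i\in I$: $\sum_{a=1}^g[x^a_i,y^a_i]+\sum_{j\in I\setminus\{i\}}t_{ij}=(g-1)t_{ii}$. Here the index sets are $\{1,\dots,n,*,0\}$ and $\{1,\dots,n,0\}$. $H=\mathrm{Span}_\mathbb{K}\{t_{j*},x^a_*,y^a_*\}_{1\le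 j\le n,1\le a\le g}$ (formal symbols), and $\mathfrak{u}^f_{g,12\cdots n}=L(H)\oplus\mathbb{K}t_{**}$ is the direct sum of the free Lie algebra on $H$ and the one-dimensional abelian Lie algebra spanned by $t_{**}$. The homomorphism $\iota$ sends each generator $t_{j*},x^a_*,y^a_*,t_{**}$ to the element of $\mathfrak{t}^f_{g,12\cdots n*0}$ with the same name. $\varepsilon^*$ sends every generator carrying an index $*$ (namely $t_{i*},t_{**},x^a_*,y^a_*$) to $0$ and every other generator to the generator of the same name. $\circ_0\mathrm{id}_{*0}$ is the homomorphism with $t_{ij}\mapsto t_{ij}$ and $x^a_i\mapsto x^a_i$, $y^a_i\mapsto y^a_i$ for $1\le i,j\le n$; $t_{i0}\mapsto t_{i*}+t_{i0}$; $t_{00}\mapsto t_{**}+2t_{*0}+t_{00}$; $x^a_0\mapsto x^a_*+x^a_0$; and $y^a_0\mapsto y^a_*+y^a_0$. *)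

theory Defs
  imports Main
begin

text \<open>Lie algebras over a field presented by generators and relations, realised as
  quotients of the free (non-associative) magma algebra on the generators by the
  Lie ideal generated by antisymmetry (alternating law), Jacobi identity and the
  given relators.  Elements of the magma algebra on a generator type 'x are
  finitely supported functions  'x tree \<Rightarrow> 'k  (coefficient of each bracket word);
  an element of the presented Lie algebra is represented by any of its lifts, so
  statements about the quotient are stated via membership in the ideal.\<close>

datatype 'x tree = Leaf 'x | Br "'x tree" "'x tree"

fun leaves :: "'x tree \<Rightarrow> 'x set" where
  "leaves (Leaf x) = {x}"
| "leaves (Br a b) = leaves a \<union> leaves b"

text \<open>u is an element of the magma algebra on the generator set G.\<close>
definition in_mag :: "'x set \<Rightarrow> ('x tree \<Rightarrow> 'k::zero) \<Rightarrow> bool" where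
  "in_mag G u \<longleftrightarrow> finite {t. u t \<noteq> 0} \<and> (\<forall>t. u t \<noteq> 0 \<longrightarrow> leaves t \<subseteq> G)"

definition mzero :: "'x tree \<Rightarrow> 'k::zero" where
  "mzero = (\<lambda>t. 0)"

definition gen :: "'x \<Rightarrow> 'x tree \<Rightarrow> 'k::{zero,one}" where
  "gen x = (\<lambda>t. if t = Leaf x then 1 else 0)"

definition madd :: "('x tree \<Rightarrow> 'k::plus) \<Rightarrow> ('x tree \<Rightarrow> 'k) \<Rightarrow> 'x tree \<Rightarrow> 'k" where
  "madd u v = (\<lambda>t. u t + v t)"

definition msub :: "('x tree \<Rightarrow> 'k::minus) \<Rightarrow> ('x tree \<Rightarrow> 'k) \<Rightarrow> 'x tree \<Rightarrow> 'k" where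
  "msub u v = (\<lambda>t. u t - v t)"

definition msmult :: "'k::times \<Rightarrow> ('x tree \<Rightarrow> 'k) \<Rightarrow> 'x tree \<Rightarrow> 'k" where
  "msmult c u = (\<lambda>t. c * u t)"

definition msum :: "('i \<Rightarrow> 'x tree \<Rightarrow> 'k::comm_monoid_add) \<Rightarrow> 'i set \<Rightarrow> 'x tree \<Rightarrow> 'k" where
  "msum f A = (\<lambda>t. \<Sum>i\<in>A. f i t)"

text \<open>The (bilinear) bracket of the magma algebra.\<close>
definition br :: "('x tree \<Rightarrow> 'k::semiring_0) \<Rightarrow> ('x tree \<Rightarrow> 'k) \<Rightarrow> 'x tree \<Rightarrow> 'k" where
  "br u v = (\<lambda>t. case t of Leaf _ \<Rightarrow> 0 | Br a b \<Rightarrow> u a * v b)"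

text \<open>The Lie ideal of the magma algebra on G generated by the relators R together
  with the Lie algebra axioms.\<close>
inductive_set lie_ideal :: "'x set \<Rightarrow> ('x tree \<Rightarrow> 'k::field) set \<Rightarrow> ('x tree \<Rightarrow> 'k) set"
  for G R where
  rel: "r \<in> R \<Longrightarrow> r \<in> lie_ideal G R"
| alt: "in_mag G u \<Longrightarrow> br u u \<in> lie_ideal G R"
| jac: "in_mag G u \<Longrightarrow> in_mag G v \<Longrightarrow> in_mag G w \<Longrightarrow>
          madd (madd (br u (br v w)) (br v (br w u))) (br w (br u v)) \<in> lie_ideal G R"
| zero: "mzero \<in> lie_ideal G R"
| add: "a \<in> lie_ideal G R \<Longrightarrow> b \<in> lie_ideal G R \<Longrightarrow> madd a b \<in> lie_ideal G R"
| smult: "a \<in> lie_ideal G R \<Longrightarrow> msmult c a \<in> lie_ideal G R"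
| brl: "a \<in> lie_ideal G R \<Longrightarrow> in_mag G u \<Longrightarrow> br u a \<in> lie_ideal G R"
| brr: "a \<in> lie_ideal G R \<Longrightarrow> in_mag G u \<Longrightarrow> br a u \<in> lie_ideal G R"

text \<open>The algebra homomorphism of magma algebras determined by images of generators.\<close>
fun ext_tree :: "('x \<Rightarrow> 'y tree \<Rightarrow> 'k::semiring_0) \<Rightarrow> 'x tree \<Rightarrow> 'y tree \<Rightarrow> 'k" where
  "ext_tree \<phi> (Leaf x) = \<phi> x"
| "ext_tree \<phi> (Br a b) = br (ext_tree \<phi> a) (ext_tree \<phi> b)"

definition hom :: "('x \<Rightarrow> 'y tree \<Rightarrow> 'k::semiring_0) \<Rightarrow> ('x tree \<Rightarrow> 'k) \<Rightarrow> 'y tree \<Rightarrow> 'k" where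
  "hom \<phi> u = (\<lambda>s. \<Sum>t\<in>{t. u t \<noteq> 0}. u t * ext_tree \<phi> t s)"

section \<open>The Lie algebras t^f_{g,I}\<close>

text \<open>Indices: Pt i (for 1 \<le> i \<le> n), Star (the index *), Zero (the index 0).\<close>
datatype idx = Pt nat | Star | Zero

text \<open>Generators t_ij, x^a_i, y^a_i.\<close>
datatype gen_sym = T idx idx | X nat idx | Y nat idx

definition tf_gens :: "nat \<Rightarrow> idx set \<Rightarrow> gen_sym set" where
  "tf_gens g I = {T i j | i j. i \<in> I \<and> j \<in> I}
      \<union> {X a i | a i. 1 \<le> a \<and> a \<le> g \<and> i \<in> I}
      \<union> {Y a i | a i. 1 \<le> a \<and> a \<le> g \<and> i \<in> I}"

definition tf_rels :: "nat \<Rightarrow> idx set \<Rightarrow> (gen_sym tree \<Rightarrow> 'k::field) set" where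
  "tf_rels g I =
      {msub (gen (T i j)) (gen (T j i)) | i j. i \<in> I \<and> j \<in> I}
    \<union> {br (gen (T i j)) (gen (T k l)) | i j k l.
          i \<in> I \<and> j \<in> I \<and> k \<in> I \<and> l \<in> I \<and> {i, j} \<inter> {k, l} = {}}
    \<union> {br (gen (T i j)) (madd (gen (T i k)) (gen (T j k))) | i j k.
          i \<in> I \<and> j \<in> I \<and> k \<in> I \<and> k \<notin> {i, j}}
    \<union> {msub (br (gen (X a i)) (gen (Y b j))) (if a = b then gen (T i j) else mzero) | a b i j.
          1 \<le> a \<and> a \<le> g \<and> 1 \<le> b \<and> b \<le> g \<and> i \<in> I \<and> j \<in> I \<and> i \<noteq> j}
    \<union> {br (gen (X a i)) (gen (X b j)) | a b i j.
          1 \<le> a \<and> a \<le> g \<and> 1 \<le> b \<and> b \<le> g \<and> i \<in> I \<and> j \<in> I \<and> i \<noteq> j}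
    \<union> {br (gen (Y a i)) (gen (Y b j)) | a b i j.
          1 \<le> a \<and> a \<le> g \<and> 1 \<le> b \<and> b \<le> g \<and> i \<in> I \<and> j \<in> I \<and> i \<noteq> j}
    \<union> {br (gen (X a k)) (gen (T i j)) | a i j k.
          1 \<le> a \<and> a \<le> g \<and> i \<in> I \<and> j \<in> I \<and> k \<in> I \<and> k \<notin> {i, j}}
    \<union> {br (gen (Y a k)) (gen (T i j)) | a i j k.
          1 \<le> a \<and> a \<le> g \<and> i \<in> I \<and> j \<in> I \<and> k \<in> I \<and> k \<notin> {i, j}}
    \<union> {br (madd (gen (X a i)) (gen (X a j))) (gen (T i j)) | a i j.
          1 \<le> a \<and> a \<le> g \<and> i \<in> I \<and> j \<in> I}
    \<union> {br (madd (gen (Y a i)) (gen (Y a j))) (gen (T i j)) | a i j.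
          1 \<le> a \<and> a \<le> g \<and> i \<in> I \<and> j \<in> I}
    \<union> {msub (madd (msum (\<lambda>a. br (gen (X a i)) (gen (Y a i))) {1..g})
                 (msum (\<lambda>j. gen (T i j)) (I - {i})))
            (msmult (of_nat g - 1) (gen (T i i))) | i. i \<in> I}"

text \<open>Index sets {1,...,n,*,0} and {1,...,n,0}.\<close>
definition idx_n_star_0 :: "nat \<Rightarrow> idx set" where
  "idx_n_star_0 n = Pt ` {1..n} \<union> {Star, Zero}"

definition idx_n_0 :: "nat \<Rightarrow> idx set" where
  "idx_n_0 n = Pt ` {1..n} \<union> {Zero}"

section \<open>u^f_{g,12...n} = L(H) + K t_** \<close>

text \<open>H is spanned by t_j*, x^a_*, y^a_*; the Lie algebra L(H) \<oplus> K t_** is presented by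
  the generators H together with t_** and the relations [t_**, h] = 0 for the
  generators h of H (t_** central).\<close>
definition H_gens :: "nat \<Rightarrow> nat \<Rightarrow> gen_sym set" where
  "H_gens g n = {T (Pt j) Star | j. 1 \<le> j \<and> j \<le> n}
      \<union> {X a Star | a. 1 \<le> a \<and> a \<le> g} \<union> {Y a Star | a. 1 \<le> a \<and> a \<le> g}"

definition uf_gens :: "nat \<Rightarrow> nat \<Rightarrow> gen_sym set" where
  "uf_gens g n = H_gens g n \<union> {T Star Star}"

definition uf_rels :: "nat \<Rightarrow> nat \<Rightarrow> (gen_sym tree \<Rightarrow> 'k::field) set" where
  "uf_rels g n = {br (gen (T Star Star)) (gen h) | h. h \<in> H_gens g n}"

section \<open>The maps\<close>

text \<open>iota: each generator to the generator of the same name.\<close>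
definition iota_map :: "gen_sym \<Rightarrow> gen_sym tree \<Rightarrow> 'k::field" where
  "iota_map s = gen s"

definition has_star :: "gen_sym \<Rightarrow> bool" where
  "has_star s = (case s of T i j \<Rightarrow> i = Star \<or> j = Star | X a i \<Rightarrow> i = Star | Y a i \<Rightarrow> i = Star)"

text \<open>epsilon^*: generators carrying the index * go to 0, the others to themselves.\<close>
definition eps_map :: "gen_sym \<Rightarrow> gen_sym tree \<Rightarrow> 'k::field" where
  "eps_map s = (if has_star s then mzero else gen s)"

text \<open>The splitting \<circ>_0 id_{*0}.  The symbol t_{0i} (= t_{i0}) is sent to the same
  element as t_{i0}.\<close>
fun split_map :: "gen_sym \<Rightarrow> gen_sym tree \<Rightarrow> 'k::field" where
  "split_map (T (Pt i) Zero) = madd (gen (T (Pt i) Star)) (gen (T (Pt i) Zero))"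
| "split_map (T Zero (Pt i)) = madd (gen (T (Pt i) Star)) (gen (T (Pt i) Zero))"
| "split_map (T Zero Zero) =
     madd (madd (gen (T Star Star)) (msmult 2 (gen (T Star Zero)))) (gen (T Zero Zero))"
| "split_map (X a Zero) = madd (gen (X a Star)) (gen (X a Zero))"
| "split_map (Y a Zero) = madd (gen (Y a Star)) (gen (Y a Zero))"
| "split_map s = gen s"

end

(* The image of iota is an ideal: brackets of its generators with all generators of the middle Lie
   algebra stay inside it, and t_{0*} lies in it by the last relation for the strand *. It contains
   all generators with index *, and every v agrees modulo it with its image under epsilon^* followed
   by the splitting; hence it is the kernel of epsilon^*.

   For the injectivity of iota, the brackets just computed are taken as the definition of
   derivations of u = L(H) + K t_{**}, which are given by their values on generators since t_{**} is
   central. In the semidirect product of u with its derivations one finds elements satisfying all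
   relations of the middle Lie algebra, where the generators with index * are those of u itself.
   The resulting homomorphism composed with iota is the inclusion of u. Only the presentation of u
   is used, no structure theory of free Lie algebras. *)
theory Submission
  imports Defs Complex_Main "HOL-Library.Function_Algebras" "HOL-Library.Product_Plus"
begin

text \<open>The obstacle is that nothing bounds the middle algebra from below: an element of u might
  be killed by consequences of relations that involve the other strands. This is excluded by a Lie
  algebra that satisfies all those relations and visibly contains u. An element v + D of it is
  stored with its total action ad v + D. The relations prescribe how t_ij, x_i, y_i act on u, that
  is the total action, while v is forced by the splitting; so neither component has to be solved
  for. The element t_{0*} is not a generator of u but is solved from the last relation for the
  strand \<open>Star\<close>. Its image under a derivation must therefore be computed; it obeys the
  same formula as the images of the other t_{k*}, because the prescribed values are compatible with
  that relation. After this the index 0 is no exception in the formulas for the action.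
  Characteristic 0 enters where a relation with equal indices reads 2 [p, q] = 0. It makes every
  t_ii central, and iota is well defined only because t_{**} is.\<close>

text \<open>Goals of the induction methods contain eta-expanded functions, below which these rules would
  destroy sums of functions.\<close>
lemmas fun_ops = plus_fun_apply zero_fun_apply minus_apply uminus_apply
declare fun_ops [simp del]

section \<open>Lie algebras on a subspace\<close>

text \<open>The carrier \<open>S\<close> is needed for the semidirect product, where bilinearity
  holds only for pairs whose second component is a derivation. All other instances have carrier
  \<open>UNIV\<close>.\<close>

locale bilinear_on = vector_space sc
  for sc :: "'k::field \<Rightarrow> 'a::ab_group_add \<Rightarrow> 'a" +
  fixes S :: "'a set" and B :: "'a \<Rightarrow> 'a \<Rightarrow> 'a"
  assumes subspace_carrier: "subspace S"
    and B_closed [simp]: "x \<in> S \<Longrightarrow> y \<in> S \<Longrightarrow> B x y \<in> S"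
    and B_add_left: "x \<in> S \<Longrightarrow> y \<in> S \<Longrightarrow> z \<in> S \<Longrightarrow> B (x + y) z = B x z + B y z"
    and B_add_right: "x \<in> S \<Longrightarrow> y \<in> S \<Longrightarrow> z \<in> S \<Longrightarrow> B x (y + z) = B x y + B x z"
    and B_scale_left: "x \<in> S \<Longrightarrow> y \<in> S \<Longrightarrow> B (sc c x) y = sc c (B x y)"
    and B_scale_right: "x \<in> S \<Longrightarrow> y \<in> S \<Longrightarrow> B x (sc c y) = sc c (B x y)"
begin

lemma zero_closed [simp]: "0 \<in> S"
  and add_closed [simp]: "x \<in> S \<Longrightarrow> y \<in> S \<Longrightarrow> x + y \<in> S"
  and scale_closed [simp]: "x \<in> S \<Longrightarrow> sc c x \<in> S"
  and uminus_closed [simp]: "x \<in> S \<Longrightarrow> - x \<in> S"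
  and diff_closed [simp]: "x \<in> S \<Longrightarrow> y \<in> S \<Longrightarrow> x - y \<in> S"
  and sum_closed [simp]: "(\<And>i. i \<in> A \<Longrightarrow> f i \<in> S) \<Longrightarrow> sum f A \<in> S"
  using subspace_carrier
  by (auto intro: subspace_0 subspace_add subspace_scale subspace_neg subspace_diff subspace_sum)

lemma B_zero_left [simp]: "x \<in> S \<Longrightarrow> B 0 x = 0"
  using B_scale_left[of 0 x 0] by simp

lemma B_zero_right [simp]: "x \<in> S \<Longrightarrow> B x 0 = 0"
  using B_scale_right[of x 0 0] by simp

lemma B_minus_left: "x \<in> S \<Longrightarrow> y \<in> S \<Longrightarrow> B (- x) y = - B x y"
  using B_scale_left[of x y "-1"] by simp

lemma B_minus_right: "x \<in> S \<Longrightarrow> y \<in> S \<Longrightarrow> B x (- y) = - B x y"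
  using B_scale_right[of x y "-1"] by simp

lemma B_diff_left: "x \<in> S \<Longrightarrow> y \<in> S \<Longrightarrow> z \<in> S \<Longrightarrow> B (x - y) z = B x z - B y z"
  using B_add_left[of x "- y" z] by (simp add: B_minus_left)

lemma B_diff_right: "x \<in> S \<Longrightarrow> y \<in> S \<Longrightarrow> z \<in> S \<Longrightarrow> B x (y - z) = B x y - B x z"
  using B_add_right[of x y "- z"] by (simp add: B_minus_right)

lemma B_sum_left: "(\<And>i. i \<in> A \<Longrightarrow> f i \<in> S) \<Longrightarrow> y \<in> S \<Longrightarrow> B (sum f A) y = (\<Sum>i\<in>A. B (f i) y)"
  by (induction A rule: infinite_finite_induct) (simp_all add: B_add_left)

lemma B_sum_right: "(\<And>i. i \<in> A \<Longrightarrow> f i \<in> S) \<Longrightarrow> y \<in> S \<Longrightarrow> B y (sum f A) = (\<Sum>i\<in>A. B y (f i))"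
  by (induction A rule: infinite_finite_induct) (simp_all add: B_add_right)

lemmas B_bilinear = B_add_left B_add_right B_scale_left B_scale_right B_minus_left B_minus_right
  B_diff_left B_diff_right B_sum_left B_sum_right

end

locale lie_on = bilinear_on +
  assumes B_self: "x \<in> S \<Longrightarrow> B x x = 0"
    and B_jacobi: "x \<in> S \<Longrightarrow> y \<in> S \<Longrightarrow> z \<in> S \<Longrightarrow> B x (B y z) + B y (B z x) + B z (B x y) = 0"
begin

lemma B_anti:
  assumes "x \<in> S" "y \<in> S" shows "B x y = - B y x"
proof -
  have "0 = B (x + y) (x + y)" using assms by (simp only: B_self add_closed)
  also have "\<dots> = B x x + B y x + (B x y + B y y)"
    using assms by (simp only: B_add_left B_add_right add_closed)
  finally show ?thesis using assms by (simp add: B_self eq_neg_iff_add_eq_0 add.commute)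
qed

lemma B_leibniz: "x \<in> S \<Longrightarrow> y \<in> S \<Longrightarrow> z \<in> S \<Longrightarrow> B x (B y z) = B (B x y) z + B y (B x z)"
  using B_jacobi[of x y z] B_anti[of z x] B_anti[of z "B x y"]
  by (simp add: B_bilinear algebra_simps)

end

section \<open>The magma algebra\<close>

text \<open>Moves the pointwise operations to the type classes, so that group and sum lemmas apply.
  For an infinite index set both sums are 0.\<close>

lemma mag_ops [simp]:
  "madd u v = u + v" "msub u v = u - v" "mzero = 0" "msum f A = sum f A"
proof -
  show "msum f A = sum f A"
    by (induction A rule: infinite_finite_induct) (auto simp: msum_def fun_eq_iff fun_ops)
qed (auto simp: fun_eq_iff fun_ops madd_def msub_def mzero_def)

lemma sum_fun_apply: "(\<Sum>i\<in>A. f i) x = (\<Sum>i\<in>A. f i x)"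
  by (induction A rule: infinite_finite_induct) (auto simp: fun_ops)

lemma vector_space_msmult: "vector_space (msmult :: 'k::field \<Rightarrow> ('x tree \<Rightarrow> 'k) \<Rightarrow> _)"
  by unfold_locales (auto simp: fun_ops msmult_def fun_eq_iff algebra_simps)

lemma bilinear_on_br: "bilinear_on (msmult :: 'k::field \<Rightarrow> ('x tree \<Rightarrow> 'k) \<Rightarrow> _) UNIV br"
proof -
  interpret vector_space "msmult :: 'k \<Rightarrow> ('x tree \<Rightarrow> 'k) \<Rightarrow> _" by (rule vector_space_msmult)
  show ?thesis
    by unfold_locales (auto simp: fun_ops msmult_def br_def fun_eq_iff algebra_simps split:
        tree.split)
qed

lemma in_mag_zero [simp]: "in_mag G 0"
  by (simp add: in_mag_def fun_ops)

lemma in_mag_add [simp]: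
  fixes u v :: "'x tree \<Rightarrow> 'k::field"
  assumes "in_mag G u" "in_mag G v" shows "in_mag G (u + v)"
proof -
  have "{t. (u + v) t \<noteq> 0} \<subseteq> {t. u t \<noteq> 0} \<union> {t. v t \<noteq> 0}" by (auto simp: fun_ops)
  moreover have "finite \<dots>" using assms by (simp add: in_mag_def)
  ultimately show ?thesis using assms by (auto simp: in_mag_def fun_ops intro: finite_subset)
qed

lemma in_mag_smult [simp]:
  fixes u :: "'x tree \<Rightarrow> 'k::field"
  assumes "in_mag G u" shows "in_mag G (msmult c u)"
  using assms unfolding in_mag_def msmult_def by (auto elim: rev_finite_subset)

lemma subspace_in_mag: "module.subspace msmult (Collect (in_mag G) :: ('x tree \<Rightarrow> 'k::field) set)"
proof -
  interpret vector_space "msmult :: 'k \<Rightarrow> ('x tree \<Rightarrow> 'k) \<Rightarrow> _" by (rule vector_space_msmult)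
  show ?thesis by (rule subspaceI) auto
qed

lemma in_mag_br [simp]:
  fixes u v :: "'x tree \<Rightarrow> 'k::field"
  assumes "in_mag G u" "in_mag G v" shows "in_mag G (br u v)"
proof -
  have "{t. br u v t \<noteq> 0} \<subseteq> (\<lambda>(a, b). Br a b) ` ({t. u t \<noteq> 0} \<times> {t. v t \<noteq> 0})"
  proof
    fix t assume "t \<in> {t. br u v t \<noteq> 0}"
    then show "t \<in> (\<lambda>(a, b). Br a b) ` ({t. u t \<noteq> 0} \<times> {t. v t \<noteq> 0})"
      by (cases t) (auto simp: br_def)
  qed
  moreover have "finite \<dots>" using assms by (auto simp: in_mag_def)
  ultimately have "finite {t. br u v t \<noteq> 0}" by (rule finite_subset)
  then show ?thesis using assms unfolding in_mag_def by (auto simp: br_def split: tree.splits)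
qed

lemma in_mag_gen: "x \<in> G \<Longrightarrow> in_mag G (gen x :: 'x tree \<Rightarrow> 'k::field)"
  by (auto simp: in_mag_def gen_def)

lemma in_mag_diff [simp]:
  fixes u v :: "'x tree \<Rightarrow> 'k::field"
  assumes "in_mag G u" "in_mag G v" shows "in_mag G (u - v)"
proof -
  have "u - v = u + msmult (- 1) v" by (auto simp: fun_ops msmult_def fun_eq_iff)
  then show ?thesis using assms by (metis in_mag_add in_mag_smult)
qed

lemma in_mag_sum [simp]:
  fixes f :: "'i \<Rightarrow> 'x tree \<Rightarrow> 'k::field"
  shows "(\<And>i. i \<in> A \<Longrightarrow> in_mag G (f i)) \<Longrightarrow> in_mag G (sum f A)"
  by (induction A rule: infinite_finite_induct) auto

lemma in_mag_mono: "in_mag G u \<Longrightarrow> G \<subseteq> G' \<Longrightarrow> in_mag G' u"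
  by (auto simp: in_mag_def)

definition monom :: "'x tree \<Rightarrow> 'x tree \<Rightarrow> 'k::field" where
  "monom t = (\<lambda>s. if s = t then 1 else 0)"

lemma monom_simps [simp]:
  "monom (Leaf x) = gen x" "monom (Br a b) = br (monom a) (monom b)"
  by (auto simp: monom_def gen_def br_def fun_eq_iff split: tree.splits)

lemma in_mag_monom: "leaves t \<subseteq> G \<Longrightarrow> in_mag G (monom t :: 'x tree \<Rightarrow> 'k::field)"
  by (auto simp: in_mag_def monom_def)

lemma mag_eq_sum_monom:
  fixes u :: "'x tree \<Rightarrow> 'k::field"
  assumes "finite {t. u t \<noteq> 0}"
  shows "u = (\<Sum>t\<in>{t. u t \<noteq> 0}. msmult (u t) (monom t))"
proof
  fix s
  have "(\<Sum>t\<in>{t. u t \<noteq> 0}. msmult (u t) (monom t)) s = (\<Sum>t\<in>{t. u t \<noteq> 0}. if s = t then u t else 0)"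
    by (auto simp: sum_fun_apply msmult_def monom_def intro!: sum.cong)
  also have "\<dots> = u s" using assms by simp
  finally show "u s = (\<Sum>t\<in>{t. u t \<noteq> 0}. msmult (u t) (monom t)) s" by simp
qed

lemma in_mag_induct [consumes 1, case_names zero add smult gen br]:
  fixes u :: "'x tree \<Rightarrow> 'k::field"
  assumes u: "in_mag G u"
    and zero: "Q 0"
    and add: "\<And>u v. in_mag G u \<Longrightarrow> in_mag G v \<Longrightarrow> Q u \<Longrightarrow> Q v \<Longrightarrow> Q (u + v)"
    and smult: "\<And>c u. in_mag G u \<Longrightarrow> Q u \<Longrightarrow> Q (msmult c u)"
    and gen: "\<And>x. x \<in> G \<Longrightarrow> Q (gen x)"
    and br: "\<And>u v. in_mag G u \<Longrightarrow> in_mag G v \<Longrightarrow> Q u \<Longrightarrow> Q v \<Longrightarrow> Q (br u v)"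
  shows "Q u"
proof -
  have Q_monom: "leaves t \<subseteq> G \<Longrightarrow> Q (monom t)" for t
  proof (induction t)
    case (Br a b)
    then show ?case by (auto intro!: br in_mag_monom)
  qed (simp add: gen)
  have "in_mag G (\<Sum>t\<in>A. msmult (u t) (monom t)) \<and> Q (\<Sum>t\<in>A. msmult (u t) (monom t))"
    if "finite A" "A \<subseteq> {t. u t \<noteq> 0}" for A
    using that
  proof (induction A rule: finite_induct)
    case (insert t A)
    moreover have "leaves t \<subseteq> G" using u insert.prems by (auto simp: in_mag_def)
    ultimately show ?case by (auto intro!: add smult Q_monom simp: in_mag_monom)
  qed (simp add: zero)
  from this[of "{t. u t \<noteq> 0}"] show ?thesis
    using mag_eq_sum_monom[of u] u by (auto simp: in_mag_def)
qed

section \<open>Evaluation of the magma algebra\<close>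

primrec evt :: "('a \<Rightarrow> 'a \<Rightarrow> 'a) \<Rightarrow> ('x \<Rightarrow> 'a) \<Rightarrow> 'x tree \<Rightarrow> 'a" where
  "evt B \<phi> (Leaf x) = \<phi> x"
| "evt B \<phi> (Br a b) = B (evt B \<phi> a) (evt B \<phi> b)"

text \<open>Generalises \<open>hom\<close> to an arbitrary target: besides magma algebras it is used
  for quotients, dual numbers and the semidirect product.\<close>

definition ev :: "('k::zero \<Rightarrow> 'a \<Rightarrow> 'a::comm_monoid_add) \<Rightarrow> ('a \<Rightarrow> 'a \<Rightarrow> 'a) \<Rightarrow> ('x \<Rightarrow> 'a) \<Rightarrow> ('x tree
    \<Rightarrow> 'k) \<Rightarrow> 'a"
  where "ev sc B \<phi> u = (\<Sum>t\<in>{t. u t \<noteq> 0}. sc (u t) (evt B \<phi> t))"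

abbreviation fin :: "('x tree \<Rightarrow> 'k::zero) \<Rightarrow> bool" where
  "fin \<equiv> in_mag UNIV"

lemma in_mag_fin: "in_mag G u \<Longrightarrow> fin u"
  by (rule in_mag_mono) auto

context bilinear_on
begin

lemma ev_superset:
  assumes "finite A" "{t. u t \<noteq> 0} \<subseteq> A"
  shows "ev sc B \<phi> u = (\<Sum>t\<in>A. sc (u t) (evt B \<phi> t))"
  unfolding ev_def using assms by (intro sum.mono_neutral_left) auto

lemma ev_zero [simp]: "ev sc B \<phi> 0 = 0"
  by (simp add: ev_def fun_ops)

lemma ev_gen [simp]: "ev sc B \<phi> (gen x) = \<phi> x"
  by (subst ev_superset[of "{Leaf x}"]) (auto simp: gen_def)

lemma ev_add [simp]:
  assumes "fin u" "fin v" shows "ev sc B \<phi> (u + v) = ev sc B \<phi> u + ev sc B \<phi> v"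
proof -
  let ?A = "{t. u t \<noteq> 0} \<union> {t. v t \<noteq> 0}"
  have "finite ?A" using assms by (auto simp: in_mag_def)
  then show ?thesis
    by (subst (1 2 3) ev_superset[of ?A]) (auto simp: fun_ops scale_left_distrib sum.distrib)
qed

lemma ev_smult [simp]:
  assumes "fin u" shows "ev sc B \<phi> (msmult c u) = sc c (ev sc B \<phi> u)"
proof -
  let ?A = "{t. u t \<noteq> 0}"
  have "finite ?A" using assms by (auto simp: in_mag_def)
  then show ?thesis
    by (subst (1 2) ev_superset[of ?A]) (auto simp: scale_sum_right msmult_def)
qed

lemma ev_diff [simp]:
  assumes "fin u" "fin v" shows "ev sc B \<phi> (u - v) = ev sc B \<phi> u - ev sc B \<phi> v"
proof -
  have "ev sc B \<phi> u = ev sc B \<phi> ((u - v) + v)" by simp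
  also have "\<dots> = ev sc B \<phi> (u - v) + ev sc B \<phi> v"
    using assms by (intro ev_add) auto
  finally show ?thesis by simp
qed

lemma ev_sum [simp]:
  assumes "\<And>i. i \<in> A \<Longrightarrow> fin (f i)" shows "ev sc B \<phi> (sum f A) = (\<Sum>i\<in>A. ev sc B \<phi> (f i))"
  using assms by (induction A rule: infinite_finite_induct) auto

context
  fixes \<phi> :: "'x \<Rightarrow> 'a"
  assumes in_carrier: "\<And>x. \<phi> x \<in> S"
begin

lemma evt_closed [simp]: "evt B \<phi> t \<in> S"
  by (induction t) (auto simp: in_carrier)

lemma ev_closed [simp]: "ev sc B \<phi> u \<in> S"
  by (simp add: ev_def)

lemma ev_br [simp]:
  assumes "fin u" "fin v" shows "ev sc B \<phi> (br u v) = B (ev sc B \<phi> u) (ev sc B \<phi> v)"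
proof -
  let ?U = "{t. u t \<noteq> 0}" and ?V = "{t. v t \<noteq> 0}"
  let ?A = "(\<lambda>(a, b). Br a b) ` (?U \<times> ?V)"
  have fin: "finite ?U" "finite ?V" using assms by (auto simp: in_mag_def)
  have sub: "{t. br u v t \<noteq> 0} \<subseteq> ?A"
  proof
    fix t assume "t \<in> {t. br u v t \<noteq> 0}"
    then show "t \<in> ?A" by (cases t) (auto simp: br_def)
  qed
  have "ev sc B \<phi> (br u v) = (\<Sum>t\<in>?A. sc (br u v t) (evt B \<phi> t))"
    using fin sub by (intro ev_superset) auto
  also have "\<dots> = (\<Sum>(a, b)\<in>?U \<times> ?V. sc (u a * v b) (B (evt B \<phi> a) (evt B \<phi> b)))"
    by (subst sum.reindex) (auto simp: inj_on_def br_def intro!: sum.cong)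
  also have "\<dots> = B (ev sc B \<phi> u) (ev sc B \<phi> v)"
    unfolding ev_def
    by (subst sum.cartesian_product[symmetric])
      (subst sum.swap, simp add: B_sum_left B_sum_right B_scale_left B_scale_right in_carrier
        scale_sum_right mult.commute)
  finally show ?thesis .
qed

end

end

text \<open>The universal property of a presentation: in a Lie algebra the alternating law and
  Jacobi hold anyway, so only the relators have to be checked. The assignment must take values in
  \<open>S\<close> on all symbols, also outside \<open>G\<close>.\<close>

lemma (in lie_on) ev_lie_ideal:
  assumes in_carrier: "\<And>x. \<phi> x \<in> S"
    and R: "\<And>r. r \<in> R \<Longrightarrow> fin r \<and> ev sc B \<phi> r = 0"
    and u: "u \<in> lie_ideal G R"
  shows "fin u \<and> ev sc B \<phi> u = 0"
  using u
proof induction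
  case (jac u v w)
  then have "fin u" "fin v" "fin w" by (auto intro: in_mag_fin)
  then show ?case by (simp add: in_carrier B_jacobi)
qed (auto simp: in_carrier B_self R dest: in_mag_fin)

lemma hom_eq_ev: "hom \<phi> u = ev msmult br \<phi> u"
proof -
  have "ext_tree \<phi> t = evt br \<phi> t" for t by (induction t) auto
  then show ?thesis by (auto simp: hom_def ev_def fun_eq_iff sum_fun_apply msmult_def)
qed

lemma in_mag_evt: "(\<And>x. x \<in> G \<Longrightarrow> in_mag G' (\<phi> x)) \<Longrightarrow> leaves t \<subseteq> G
    \<Longrightarrow> in_mag G' (evt br \<phi> t :: 'y tree \<Rightarrow> 'k::field)"
  by (induction t) auto

lemma in_mag_hom:
  fixes u :: "'x tree \<Rightarrow> 'k::field"
  assumes "in_mag G u" "\<And>x. x \<in> G \<Longrightarrow> in_mag G' (\<phi> x)"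
  shows "in_mag G' (hom \<phi> u)"
  using assms unfolding hom_eq_ev ev_def
  by (intro in_mag_sum in_mag_smult in_mag_evt[of G]) (auto simp: in_mag_def)

section \<open>Presented Lie algebras\<close>

text \<open>Extend a basis \<open>A\<close> of \<open>I\<close> to a basis \<open>C\<close> of
  \<open>W\<close> and this to a basis \<open>D\<close> of the whole space. The map that fixes
  \<open>C - A\<close> and kills the other basis vectors has image isomorphic to \<open>W\<close>
  modulo \<open>I\<close>.\<close>

lemma (in vector_space) exists_projection:
  assumes I: "subspace I" and W: "subspace W" and "I \<subseteq> W"
  shows "\<exists>P. (\<forall>x y. P (x + y) = P x + P y) \<and> (\<forall>c x. P (c *s x) = c *s P x) \<and>
    (\<forall>x. P x \<in> W) \<and> (\<forall>x. P (P x) = P x) \<and> (\<forall>x\<in>W. x - P x \<in> I) \<and> (\<forall>x\<in>I. P x = 0)"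
proof -
  interpret vs: vector_space_pair scale scale by unfold_locales
  obtain A where A: "A \<subseteq> I" "independent A" "I \<subseteq> span A"
    using maximal_independent_subset by metis
  then have "A \<subseteq> W" using assms by auto
  then obtain C where C: "A \<subseteq> C" "C \<subseteq> W" "independent C" "W \<subseteq> span C"
    using maximal_independent_subset_extend[OF _ A(2)] by metis
  obtain D where D: "C \<subseteq> D" "independent D" "UNIV \<subseteq> span D"
    using maximal_independent_subset_extend[OF _ C(3), of UNIV] by auto
  define P where "P = vs.construct D (\<lambda>b. if b \<in> C - A then b else 0)"
  have basis: "b \<in> D \<Longrightarrow> P b = (if b \<in> C - A then b else 0)" for b
    unfolding P_def using D(2) by (simp add: vs.construct_basis)
  interpret P: Vector_Spaces.linear scale scale P
    unfolding P_def using D(2) by (rule vs.linear_construct)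
  have W': "P x \<in> W" for x
  proof -
    have "x \<in> span D" using D(3) by auto
    then show ?thesis
    proof (induction rule: span_induct)
      show "subspace {x. P x \<in> W}"
        using W by (auto intro!: subspaceI simp: P.add P.scale P.zero subspace_0 subspace_add
            subspace_scale)
    qed (use C W in \<open>auto simp: basis subspace_0\<close>)
  qed
  have PI: "P x = 0" if "x \<in> I" for x
  proof -
    have "x \<in> span A" using A that by auto
    then show ?thesis
    proof (induction rule: span_induct)
      show "subspace {x. P x = 0}" by (auto intro!: subspaceI simp: P.add P.scale P.zero)
    qed (use A C D in \<open>auto simp: basis\<close>)
  qed
  have diff: "x - P x \<in> I" if "x \<in> W" for x
  proof -
    have "x \<in> span C" using C that by auto
    then show ?thesis
    proof (induction rule: span_induct)
      have "x + y - P (x + y) \<in> I" if "x - P x \<in> I" "y - P y \<in> I" for x y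
        using subspace_add[OF I that] by (simp add: P.add algebra_simps)
      moreover have "c *s x - P (c *s x) \<in> I" if "x - P x \<in> I" for c x
        using subspace_scale[OF I that] by (simp add: P.scale scale_right_diff_distrib)
      ultimately show "subspace {x. x - P x \<in> I}"
        using I by (auto intro!: subspaceI simp: P.zero subspace_0)
    next
      show "b - P b \<in> I" if "b \<in> C" for b
      proof (cases "b \<in> A")
        case True
        then have "b \<in> I" "b \<in> D" using A C D by auto
        then show ?thesis using True by (simp add: basis)
      next
        case False
        have "b \<in> D" using that D by auto
        then show ?thesis using False that I by (simp add: basis subspace_0)
      qed
    qed
  qed
  have "P (P x) = P x" for x
  proof -
    have "x \<in> span D" using D(3) by auto
    then show ?thesis
    proof (induction rule: span_induct)
      show "subspace {x. P (P x) = P x}" by (auto intro!: subspaceI simp: P.add P.scale P.zero)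
    qed (use C D in \<open>auto simp: basis P.zero\<close>)
  qed
  then show ?thesis using W' PI diff P.add P.scale by metis
qed

locale presentation =
  fixes G :: "'x set" and R :: "('x tree \<Rightarrow> 'k::field) set"
  assumes relators: "r \<in> R \<Longrightarrow> in_mag G r"
begin

abbreviation "I \<equiv> lie_ideal G R"

lemma ideal_in_mag: "u \<in> I \<Longrightarrow> in_mag G u"
  by (induction rule: lie_ideal.induct) (auto intro: relators)

lemma ideal_subspace: "module.subspace msmult I"
proof -
  interpret vector_space "msmult :: 'k \<Rightarrow> ('x tree \<Rightarrow> 'k) \<Rightarrow> _" by (rule vector_space_msmult)
  show ?thesis
    using lie_ideal.zero[of G R] lie_ideal.add[of _ G R] lie_ideal.smult[of _ G R]
    unfolding mag_ops by (rule subspaceI)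
qed

text \<open>The quotient by the ideal is realised on the whole function type through a linear
  projection that kills the ideal and takes values in the magma algebra on G; so its bracket is
  total and equations in it are genuine equations.\<close>

definition P :: "('x tree \<Rightarrow> 'k) \<Rightarrow> ('x tree \<Rightarrow> 'k)" where
  "P = (SOME P. (\<forall>x y. P (x + y) = P x + P y) \<and> (\<forall>c x. P (msmult c x) = msmult c (P x)) \<and>
    (\<forall>x. P x \<in> Collect (in_mag G)) \<and> (\<forall>x. P (P x) = P x) \<and>
    (\<forall>x\<in>Collect (in_mag G). x - P x \<in> I) \<and> (\<forall>x\<in>I. P x = 0))"

definition qbr :: "('x tree \<Rightarrow> 'k) \<Rightarrow> ('x tree \<Rightarrow> 'k) \<Rightarrow> ('x tree \<Rightarrow> 'k)" where
  "qbr u v = P (br (P u) (P v))"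

lemma P_add: "P (u + v) = P u + P v"
  and P_smult: "P (msmult c u) = msmult c (P u)"
  and P_in_mag [simp]: "in_mag G (P u)"
  and P_idem [simp]: "P (P u) = P u"
  and P_diff_ideal: "in_mag G u \<Longrightarrow> u - P u \<in> I"
  and P_ideal: "u \<in> I \<Longrightarrow> P u = 0"
proof -
  interpret vector_space "msmult :: 'k \<Rightarrow> ('x tree \<Rightarrow> 'k) \<Rightarrow> _" by (rule vector_space_msmult)
  note * = someI_ex[OF exists_projection[OF ideal_subspace subspace_in_mag[of G]], folded P_def]
  have "I \<subseteq> Collect (in_mag G)" using ideal_in_mag by auto
  note * = *[OF this]
  show "P (u + v) = P u + P v" "P (msmult c u) = msmult c (P u)" "in_mag G (P u)"
    "P (P u) = P u" "in_mag G u \<Longrightarrow> u - P u \<in> I" "u \<in> I \<Longrightarrow> P u = 0"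
    using * by simp_all
qed

lemma P_zero [simp]: "P 0 = 0"
  using P_add[of 0 0] by simp

lemma P_diff: "P (u - v) = P u - P v"
  using P_add[of "u - v" v] by (simp add: eq_diff_eq)

lemma P_eq_0_iff: "in_mag G u \<Longrightarrow> P u = 0 \<longleftrightarrow> u \<in> I"
  using P_diff_ideal[of u] P_ideal[of u] by (metis diff_zero)

lemma P_br: 
  assumes "in_mag G u" "in_mag G v" shows "P (br u v) = qbr (P u) (P v)"
proof -
  interpret br: bilinear_on "msmult :: 'k \<Rightarrow> ('x tree \<Rightarrow> 'k) \<Rightarrow> _" UNIV br by (rule bilinear_on_br)
  \<comment> \<open>The factors are replaced by their projections one at a time, each at the cost of
    an element of the ideal.\<close>
  have "br (u - P u) v \<in> I" using assms by (intro lie_ideal.brr P_diff_ideal)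
  moreover have "br (P u) (v - P v) \<in> I" using assms by (intro lie_ideal.brl P_diff_ideal P_in_mag)
  ultimately have "P (br (u - P u) v) = 0" "P (br (P u) (v - P v)) = 0" by (auto simp: P_ideal)
  then show ?thesis by (simp add: br.B_diff_left br.B_diff_right P_diff qbr_def)
qed

lemma qbr_P: "qbr (P u) v = qbr u v" "qbr u (P v) = qbr u v"
  by (simp_all add: qbr_def)

lemma lie_on_qbr: "lie_on msmult UNIV qbr"
proof -
  interpret br: bilinear_on "msmult :: 'k \<Rightarrow> ('x tree \<Rightarrow> 'k) \<Rightarrow> _" UNIV br by (rule bilinear_on_br)
  have jacobi: "qbr x (qbr y z) + qbr y (qbr z x) + qbr z (qbr x y) = 0" for x y z
  proof -
    have "br (P x) (br (P y) (P z)) + br (P y) (br (P z) (P x)) + br (P z) (br (P x) (P y)) \<in> I"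
      using lie_ideal.jac[of G "P x" "P y" "P z" R] unfolding mag_ops by simp
    from P_ideal[OF this] show ?thesis by (simp add: P_add P_br qbr_P)
  qed
  have self: "qbr x x = 0" for x
    using lie_ideal.alt[of G "P x" R] by (simp add: qbr_def P_ideal)
  show ?thesis
    by unfold_locales (simp_all add: jacobi self,
      simp_all add: qbr_def P_add P_smult br.B_bilinear)
qed

sublocale Q: lie_on msmult UNIV qbr
  by (rule lie_on_qbr)

lemma P_evt:
  assumes "\<And>x. x \<in> G' \<Longrightarrow> in_mag G (\<phi> x)" "leaves t \<subseteq> G'"
  shows "P (evt br \<phi> t) = evt qbr (\<lambda>x. P (\<phi> x)) t"
  using assms(2)
proof (induction t)
  case (Br a b)
  then have "in_mag G (evt br \<phi> a)" "in_mag G (evt br \<phi> b)"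
    using assms(1) by (auto intro: in_mag_evt)
  with Br show ?case by (simp add: P_br)
qed simp

lemma P_sum: "P (sum f A) = (\<Sum>i\<in>A. P (f i))"
  by (induction A rule: infinite_finite_induct) (simp_all add: P_add)

lemma P_hom:
  fixes u :: "'y tree \<Rightarrow> 'k"
  assumes "in_mag G' u" "\<And>x. x \<in> G' \<Longrightarrow> in_mag G (\<phi> x)"
  shows "P (hom \<phi> u) = ev msmult qbr (\<lambda>x. P (\<phi> x)) u"
  using assms unfolding hom_eq_ev ev_def P_sum P_smult
  by (intro sum.cong refl arg_cong[where f = "msmult _"] P_evt[of G'])
    (auto simp: in_mag_def)

lemma P_eq_ev:
  assumes "in_mag G u" shows "P u = ev msmult qbr (\<lambda>x. P (gen x)) u"
  using assms
proof (induction rule: in_mag_induct)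
qed (simp_all add: P_add P_smult P_br in_mag_fin)

lemma ev_relator: "r \<in> R \<Longrightarrow> ev msmult qbr (\<lambda>x. P (gen x)) r = 0"
  using P_eq_ev[of r] relators[of r] P_eq_0_iff[of r] lie_ideal.rel[of r R G] by simp

section \<open>Dual numbers over the quotient, and derivations\<close>

text \<open>A pair (p, q) stands for p + q e with e^2 = 0; \<open>dsc\<close> and \<open>dbr\<close>
  extend the scalar action and the bracket of the quotient to such elements.\<close>

definition dsc :: "'k \<Rightarrow> ('x tree \<Rightarrow> 'k) \<times> ('x tree \<Rightarrow> 'k) \<Rightarrow> ('x tree \<Rightarrow> 'k) \<times> ('x tree \<Rightarrow> 'k)" where
  "dsc c p = (msmult c (fst p), msmult c (snd p))"

definition dbr :: "('x tree \<Rightarrow> 'k) \<times> ('x tree \<Rightarrow> 'k) \<Rightarrow> ('x tree \<Rightarrow> 'k) \<times> ('x tree \<Rightarrow> 'k)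
    \<Rightarrow> ('x tree \<Rightarrow> 'k) \<times> ('x tree \<Rightarrow> 'k)" where
  "dbr p q = (qbr (fst p) (fst q), qbr (snd p) (fst q) + qbr (fst p) (snd q))"

lemma fst_dbr: "fst (dbr p q) = qbr (fst p) (fst q)"
  and fst_dsc: "fst (dsc c p) = msmult c (fst p)"
  by (simp_all add: dbr_def dsc_def)

lemma lie_on_dual_numbers: "lie_on dsc UNIV dbr"
proof -
  have "vector_space dsc" unfolding dsc_def
    by unfold_locales (auto simp: Q.scale_right_distrib Q.scale_left_distrib)
  then interpret vector_space dsc .
  show "lie_on dsc UNIV dbr"
  proof unfold_locales
    show "subspace UNIV" by simp
    fix x y z :: "('x tree \<Rightarrow> 'k) \<times> ('x tree \<Rightarrow> 'k)"
    obtain x1 x2 y1 y2 z1 z2 where xyz: "x = (x1, x2)" "y = (y1, y2)" "z = (z1, z2)"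
      by (meson surj_pair)
    \<comment> \<open>The coefficient of e is a sum of three Jacobi expressions, in each of which
      one argument is replaced by its second component.\<close>
    have "dbr x (dbr y z) + dbr y (dbr z x) + dbr z (dbr x y) =
      (qbr x1 (qbr y1 z1) + qbr y1 (qbr z1 x1) + qbr z1 (qbr x1 y1),
       (qbr x2 (qbr y1 z1) + qbr y1 (qbr z1 x2) + qbr z1 (qbr x2 y1)) +
       (qbr x1 (qbr y2 z1) + qbr y2 (qbr z1 x1) + qbr z1 (qbr x1 y2)) +
       (qbr x1 (qbr y1 z2) + qbr y1 (qbr z2 x1) + qbr z2 (qbr x1 y1)))"
      unfolding xyz dbr_def by (simp add: Q.B_bilinear algebra_simps)
    also have "\<dots> = 0" by (simp add: Q.B_jacobi zero_prod_def)
    finally show "dbr x (dbr y z) + dbr y (dbr z x) + dbr z (dbr x y) = 0" .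
    show "dbr x x = 0"
      using Q.B_anti[of "fst x" "snd x"] by (simp add: dbr_def Q.B_self zero_prod_def)
  qed (simp_all add: dsc_def dbr_def Q.B_bilinear Q.scale_right_distrib)
qed

text \<open>The last condition lets a derivation depend only on the class of its argument, so that
  equality of derivations is equality of functions on the whole type.\<close>

definition Ders :: "(('x tree \<Rightarrow> 'k) \<Rightarrow> ('x tree \<Rightarrow> 'k)) set" where
  "Ders = {D. (\<forall>u v. D (u + v) = D u + D v) \<and> (\<forall>c u. D (msmult c u) = msmult c (D u)) \<and>
    (\<forall>u v. D (qbr u v) = qbr (D u) v + qbr u (D v)) \<and> (\<forall>u. D (P u) = D u)}"

text \<open>A homomorphism to the dual numbers over the quotient, lifting the projection, is the
  same as a derivation.\<close>

lemma exists_derivation: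
  assumes rel: "\<And>r. r \<in> R \<Longrightarrow> ev dsc dbr (\<lambda>x. (P (gen x), \<delta> x)) r = 0"
  shows "\<exists>D\<in>Ders. \<forall>x\<in>G. D (gen x) = \<delta> x"
proof -
  let ?\<phi> = "\<lambda>x. (P (gen x), \<delta> x)"
  interpret L2: lie_on dsc UNIV dbr by (rule lie_on_dual_numbers)
  \<comment> \<open>Projecting the argument first makes \<open>D (P u) = D u\<close> immediate and
    puts every argument into the magma algebra on \<open>G\<close>.\<close>
  define D where "D u = snd (ev dsc dbr ?\<phi> (P u))" for u
  have kill: "ev dsc dbr ?\<phi> u = 0" if "u \<in> I" for u
    using L2.ev_lie_ideal[OF _ _ that, of ?\<phi>] rel relators by (auto intro: in_mag_fin)
  have ev_P: "ev dsc dbr ?\<phi> (P u) = ev dsc dbr ?\<phi> u" if "in_mag G u" for u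
    using kill[OF P_diff_ideal[OF that]] that by (simp add: in_mag_fin P_in_mag[THEN in_mag_fin])
  have fst_ev: "fst (ev dsc dbr ?\<phi> u) = P u" if "in_mag G u" for u
    using that
  proof (induction rule: in_mag_induct)
    case (br u v)
    then show ?case by (simp add: in_mag_fin P_br fst_dbr)
  qed (simp_all add: in_mag_fin P_add P_smult, simp_all add: fst_dsc)
  note fin_P = P_in_mag[THEN in_mag_fin]
  have "D (u + v) = D u + D v" for u v by (simp add: D_def P_add fin_P)
  moreover have "D (msmult c u) = msmult c (D u)" for c u
    by (simp add: D_def P_smult fin_P) (simp add: dsc_def)
  moreover have "D (P u) = D u" for u by (simp add: D_def)
  moreover have "D (qbr u v) = qbr (D u) v + qbr u (D v)" for u v
  proof -
    have "D (qbr u v) = snd (ev dsc dbr ?\<phi> (br (P u) (P v)))"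
      by (simp add: D_def qbr_def ev_P)
    also have "\<dots> = snd (dbr (ev dsc dbr ?\<phi> (P u)) (ev dsc dbr ?\<phi> (P v)))"
      by (simp add: fin_P)
    also have "\<dots> = qbr (D u) (fst (ev dsc dbr ?\<phi> (P v))) + qbr (fst (ev dsc dbr ?\<phi> (P u))) (D v)"
      by (simp only: dbr_def D_def snd_conv)
    finally show ?thesis by (simp add: fst_ev qbr_P)
  qed
  moreover have "D (gen x) = \<delta> x" if "x \<in> G" for x
    using that by (simp add: D_def ev_P in_mag_gen)
  ultimately show ?thesis unfolding Ders_def by blast
qed

lemma Ders_ext:
  assumes D: "D \<in> Ders" and gens: "\<And>x. x \<in> G \<Longrightarrow> D (gen x) = 0"
  shows "D = 0"
proof
  fix w
  have add: "D (u + v) = D u + D v" and smult: "D (msmult c u) = msmult c (D u)"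
    and qbr: "D (qbr u v) = qbr (D u) v + qbr u (D v)" and D_P: "D (P u) = D u" for c u v
    using D by (auto simp: Ders_def)
  have "D 0 = 0" using add[of 0 0] by simp
  have "in_mag G (P w)" by simp
  then have "D (P w) = 0"
  proof (induction rule: in_mag_induct)
    case (br u v)
    then have "D (P (br u v)) = 0" by (simp add: P_br qbr D_P)
    then show ?case by (simp only: D_P)
  qed (simp_all add: \<open>D 0 = 0\<close> add smult gens)
  then show "D w = 0 w" by (simp add: D_P fun_ops)
qed

end

section \<open>Families satisfying the relations of the framed Lie algebra\<close>

text \<open>The generators x and y are treated alike: the index (True, a) stands for the a-th x, the
  index (False, a) for the a-th y, and the symplectic form omega unites their relations.\<close>

definition cols :: "nat \<Rightarrow> (bool \<times> nat) set" where
  "cols g = UNIV \<times> {1..g}"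

definition omega :: "bool \<times> nat \<Rightarrow> bool \<times> nat \<Rightarrow> 'k::field" where
  "omega c d = (if snd c = snd d \<and> fst c \<noteq> fst d then if fst c then 1 else - 1 else 0)"

definition Z :: "bool \<times> nat \<Rightarrow> idx \<Rightarrow> gen_sym" where
  "Z c i = (if fst c then X (snd c) i else Y (snd c) i)"

lemma omega_anti: "omega c d = - omega d c"
  unfolding omega_def by (cases "snd c = snd d"; cases "fst c"; cases "fst d") simp_all

text \<open>Such a family is the same as a homomorphism from the framed Lie algebra into
  \<open>S\<close>. The maps epsilon^*, the splitting and the map to the semidirect product are all
  obtained by exhibiting a family, in an arbitrary Lie algebra and with an arbitrary index
  type.\<close>

locale tf_family = lie_on sc S B
  for sc :: "'k::field \<Rightarrow> 'a::ab_group_add \<Rightarrow> 'a" and S B +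
  fixes g :: nat and I :: "'i set" and t :: "'i \<Rightarrow> 'i \<Rightarrow> 'a" and z :: "bool \<times> nat \<Rightarrow> 'i \<Rightarrow> 'a"
  assumes finite_index: "finite I"
    and t_closed [simp]: "i \<in> I \<Longrightarrow> j \<in> I \<Longrightarrow> t i j \<in> S"
    and z_closed [simp]: "c \<in> cols g \<Longrightarrow> i \<in> I \<Longrightarrow> z c i \<in> S"
    and t_sym: "i \<in> I \<Longrightarrow> j \<in> I \<Longrightarrow> t i j = t j i"
    and t_disjoint: "i \<in> I \<Longrightarrow> j \<in> I \<Longrightarrow> k \<in> I \<Longrightarrow> l \<in> I \<Longrightarrow> {i, j} \<inter> {k, l} = {} \<Longrightarrow> B (t i j) (t k l) = 0"
    and t_triangle: "i \<in> I \<Longrightarrow> j \<in> I \<Longrightarrow> k \<in> I \<Longrightarrow> k \<notin> {i, j} \<Longrightarrow> B (t i j) (t i k + t j k) = 0"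
    and z_z: "c \<in> cols g \<Longrightarrow> d \<in> cols g \<Longrightarrow> i \<in> I \<Longrightarrow> j \<in> I \<Longrightarrow> i \<noteq> j \<Longrightarrow>
      B (z c i) (z d j) = sc (omega c d) (t i j)"
    and z_t: "c \<in> cols g \<Longrightarrow> i \<in> I \<Longrightarrow> j \<in> I \<Longrightarrow> k \<in> I \<Longrightarrow> k \<notin> {i, j} \<Longrightarrow> B (z c k) (t i j) = 0"
    and z_add_t: "c \<in> cols g \<Longrightarrow> i \<in> I \<Longrightarrow> j \<in> I \<Longrightarrow> B (z c i + z c j) (t i j) = 0"
    and z_sum: "i \<in> I \<Longrightarrow> (\<Sum>a\<in>{1..g}. B (z (True, a) i) (z (False, a) i)) + (\<Sum>j\<in>I - {i}. t i j) =
      sc (of_nat g - 1) (t i i)"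

lemma fin_gen [simp]: "fin (gen x :: 'x tree \<Rightarrow> 'k::field)"
  by (rule in_mag_gen) simp

lemma tf_rels_in_mag:
  assumes "r \<in> tf_rels g I"
  shows "in_mag (tf_gens g I) (r :: gen_sym tree \<Rightarrow> 'k::field)"
proof -
  have [simp]: "i \<in> I \<Longrightarrow> j \<in> I \<Longrightarrow> in_mag (tf_gens g I) (gen (T i j) :: _ \<Rightarrow> 'k)"
    "1 \<le> a \<Longrightarrow> a \<le> g \<Longrightarrow> i \<in> I \<Longrightarrow> in_mag (tf_gens g I) (gen (X a i) :: _ \<Rightarrow> 'k)"
    "1 \<le> a \<Longrightarrow> a \<le> g \<Longrightarrow> i \<in> I \<Longrightarrow> in_mag (tf_gens g I) (gen (Y a i) :: _ \<Rightarrow> 'k)" for a i j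
    by (auto simp: tf_gens_def intro!: in_mag_gen)
  show ?thesis
    using assms unfolding tf_rels_def mag_ops
    by (elim UnE CollectE exE conjE) (simp_all del: One_nat_def,
        intro in_mag_diff in_mag_add in_mag_sum in_mag_br in_mag_smult, simp_all del: One_nat_def)
qed

lemma uf_rels_in_mag: "r \<in> uf_rels g n \<Longrightarrow> in_mag (uf_gens g n) (r :: gen_sym tree \<Rightarrow> 'k::field)"
  by (auto simp: uf_rels_def uf_gens_def intro!: in_mag_br in_mag_gen)

lemma (in lie_on) ev_tf_rels:
  assumes \<phi>: "\<And>x. \<phi> x \<in> S"
    and "tf_family sc S B g I (\<lambda>i j. \<phi> (T i j)) (\<lambda>c i. \<phi> (Z c i))"
    and r: "r \<in> tf_rels g I"
  shows "ev sc B \<phi> r = 0"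
proof -
  interpret tf_family sc S B g I "\<lambda>i j. \<phi> (T i j)" "\<lambda>c i. \<phi> (Z c i)" by fact
  have [simp]: "a \<in> {1..g} \<Longrightarrow> (b, a) \<in> cols g" for a b by (simp add: cols_def)
  have X: "\<phi> (X a i) = \<phi> (Z (True, a) i)" and Y: "\<phi> (Y a i) = \<phi> (Z (False, a) i)" for a i
    by (simp_all add: Z_def)
  show ?thesis
    using r unfolding tf_rels_def mag_ops
  proof (elim UnE CollectE exE conjE)
    fix i j assume "r = gen (T i j) - gen (T j i)" "i \<in> I" "j \<in> I"
    then show ?thesis using t_sym[of i j] by simp
  next
    fix i j k l assume "r = br (gen (T i j)) (gen (T k l))" "i \<in> I" "j \<in> I" "k \<in> I" "l \<in> I"
        "{i, j} \<inter> {k, l} = {}"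
    then show ?thesis using t_disjoint by (simp add: \<phi>)
  next
    fix i j k assume "r = br (gen (T i j)) (gen (T i k) + gen (T j k))" "i \<in> I" "j \<in> I" "k \<in> I"
        "k \<notin> {i, j}"
    then show ?thesis using t_triangle by (simp add: \<phi>)
  next
    fix a b i j assume "r = br (gen (X a i)) (gen (Y b j)) - (if a = b then gen (T i j) else 0)"
        "1 \<le> a" "a \<le> g" "1 \<le> b" "b \<le> g" "i \<in> I" "j \<in> I" "i \<noteq> j"
    then show ?thesis using z_z[of "(True, a)" "(False, b)" i j] by (simp add: \<phi> X Y omega_def)
  next
    fix a b i j assume "r = br (gen (X a i)) (gen (X b j))" "1 \<le> a" "a \<le> g" "1 \<le> b" "b \<le> g"
        "i \<in> I" "j \<in> I" "i \<noteq> j"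
    then show ?thesis using z_z[of "(True, a)" "(True, b)" i j] by (simp add: \<phi> X Y omega_def)
  next
    fix a b i j assume "r = br (gen (Y a i)) (gen (Y b j))" "1 \<le> a" "a \<le> g" "1 \<le> b" "b \<le> g"
        "i \<in> I" "j \<in> I" "i \<noteq> j"
    then show ?thesis using z_z[of "(False, a)" "(False, b)" i j] by (simp add: \<phi> X Y omega_def)
  next
    fix a i j k assume "r = br (gen (X a k)) (gen (T i j))" "1 \<le> a" "a \<le> g" "i \<in> I" "j \<in> I"
        "k \<in> I" "k \<notin> {i, j}"
    then show ?thesis using z_t[of "(True, a)" i j k] by (simp add: \<phi> X Y)
  next
    fix a i j k assume "r = br (gen (Y a k)) (gen (T i j))" "1 \<le> a" "a \<le> g" "i \<in> I" "j \<in> I"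
        "k \<in> I" "k \<notin> {i, j}"
    then show ?thesis using z_t[of "(False, a)" i j k] by (simp add: \<phi> X Y)
  next
    fix a i j assume "r = br (gen (X a i) + gen (X a j)) (gen (T i j))" "1 \<le> a" "a \<le> g" "i \<in> I"
        "j \<in> I"
    then show ?thesis using z_add_t[of "(True, a)" i j] by (simp add: \<phi> X Y)
  next
    fix a i j assume "r = br (gen (Y a i) + gen (Y a j)) (gen (T i j))" "1 \<le> a" "a \<le> g" "i \<in> I"
        "j \<in> I"
    then show ?thesis using z_add_t[of "(False, a)" i j] by (simp add: \<phi> X Y)
  next
    fix i assume "r = (\<Sum>a\<in>{1..g}. br (gen (X a i)) (gen (Y a i)))
        + (\<Sum>j\<in>I - {i}. gen (T i j)) - msmult (of_nat g - 1) (gen (T i i))" "i \<in> I"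
    then show ?thesis using z_sum[of i] by (simp add: \<phi> X Y)
  qed
qed

text \<open>One introduction rule for each of the eleven families of relators. The union is nested
  to the left, so the number of \<open>UnI1\<close> steps counts the families listed later.\<close>

lemma tf_relsI:
  fixes g :: nat and I :: "idx set"
  defines "R \<equiv> (tf_rels g I :: (gen_sym tree \<Rightarrow> 'k::field) set)"
  shows
    "i \<in> I \<Longrightarrow> j \<in> I \<Longrightarrow>
      gen (T i j) - gen (T j i) \<in> R"
    "i \<in> I \<Longrightarrow> j \<in> I \<Longrightarrow> k \<in> I \<Longrightarrow> l \<in> I \<Longrightarrow> {i, j} \<inter> {k, l} = {} \<Longrightarrow>
      br (gen (T i j)) (gen (T k l)) \<in> R"
    "i \<in> I \<Longrightarrow> j \<in> I \<Longrightarrow> k \<in> I \<Longrightarrow> k \<notin> {i, j} \<Longrightarrow>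
      br (gen (T i j)) (gen (T i k) + gen (T j k)) \<in> R"
    "1 \<le> a \<Longrightarrow> a \<le> g \<Longrightarrow> 1 \<le> b \<Longrightarrow> b \<le> g \<Longrightarrow> i \<in> I \<Longrightarrow> j \<in> I \<Longrightarrow> i \<noteq> j \<Longrightarrow>
      br (gen (X a i)) (gen (Y b j)) - (if a = b then gen (T i j) else 0) \<in> R"
    "1 \<le> a \<Longrightarrow> a \<le> g \<Longrightarrow> 1 \<le> b \<Longrightarrow> b \<le> g \<Longrightarrow> i \<in> I \<Longrightarrow> j \<in> I \<Longrightarrow> i \<noteq> j \<Longrightarrow>
      br (gen (X a i)) (gen (X b j)) \<in> R"
    "1 \<le> a \<Longrightarrow> a \<le> g \<Longrightarrow> 1 \<le> b \<Longrightarrow> b \<le> g \<Longrightarrow> i \<in> I \<Longrightarrow> j \<in> I \<Longrightarrow> i \<noteq> j \<Longrightarrow>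
      br (gen (Y a i)) (gen (Y b j)) \<in> R"
    "1 \<le> a \<Longrightarrow> a \<le> g \<Longrightarrow> i \<in> I \<Longrightarrow> j \<in> I \<Longrightarrow> k \<in> I \<Longrightarrow> k \<notin> {i, j} \<Longrightarrow>
      br (gen (X a k)) (gen (T i j)) \<in> R"
    "1 \<le> a \<Longrightarrow> a \<le> g \<Longrightarrow> i \<in> I \<Longrightarrow> j \<in> I \<Longrightarrow> k \<in> I \<Longrightarrow> k \<notin> {i, j} \<Longrightarrow>
      br (gen (Y a k)) (gen (T i j)) \<in> R"
    "1 \<le> a \<Longrightarrow> a \<le> g \<Longrightarrow> i \<in> I \<Longrightarrow> j \<in> I \<Longrightarrow>
      br (gen (X a i) + gen (X a j)) (gen (T i j)) \<in> R"
    "1 \<le> a \<Longrightarrow> a \<le> g \<Longrightarrow> i \<in> I \<Longrightarrow> j \<in> I \<Longrightarrow>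
      br (gen (Y a i) + gen (Y a j)) (gen (T i j)) \<in> R"
    "i \<in> I \<Longrightarrow>
      (\<Sum>a\<in>{1..g}. br (gen (X a i)) (gen (Y a i))) + (\<Sum>j\<in>I - {i}. gen (T i j))
      - msmult (of_nat g - 1) (gen (T i i)) \<in> R"
  unfolding R_def tf_rels_def mag_ops
  subgoal by (rule UnI1, rule UnI1, rule UnI1, rule UnI1, rule UnI1, rule UnI1, rule UnI1,
      rule UnI1, rule UnI1, rule UnI1, rule CollectI, intro exI conjI, rule refl; assumption)
  subgoal by (rule UnI1, rule UnI1, rule UnI1, rule UnI1, rule UnI1, rule UnI1, rule UnI1,
      rule UnI1, rule UnI1, rule UnI2, rule CollectI, intro exI conjI, rule refl; assumption)
  subgoal by (rule UnI1, rule UnI1, rule UnI1, rule UnI1, rule UnI1, rule UnI1, rule UnI1,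
      rule UnI1, rule UnI2, rule CollectI, intro exI conjI, rule refl; assumption)
  subgoal by (rule UnI1, rule UnI1, rule UnI1, rule UnI1, rule UnI1, rule UnI1, rule UnI1,
      rule UnI2, rule CollectI, intro exI conjI, rule refl; assumption)
  subgoal by (rule UnI1, rule UnI1, rule UnI1, rule UnI1, rule UnI1, rule UnI1, rule UnI2,
      rule CollectI, intro exI conjI, rule refl; assumption)
  subgoal by (rule UnI1, rule UnI1, rule UnI1, rule UnI1, rule UnI1, rule UnI2, rule CollectI,
      intro exI conjI, rule refl; assumption)
  subgoal by (rule UnI1, rule UnI1, rule UnI1, rule UnI1, rule UnI2, rule CollectI,
      intro exI conjI, rule refl; assumption)
  subgoal by (rule UnI1, rule UnI1, rule UnI1, rule UnI2, rule CollectI, intro exI conjI,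
      rule refl; assumption)
  subgoal by (rule UnI1, rule UnI1, rule UnI2, rule CollectI, intro exI conjI,
      rule refl; assumption)
  subgoal by (rule UnI1, rule UnI2, rule CollectI, intro exI conjI, rule refl; assumption)
  subgoal by (rule UnI2, rule CollectI, intro exI conjI, rule refl; assumption)
  done

lemma (in lie_on) tf_family_of_ev:
  assumes \<phi>: "\<And>x. \<phi> x \<in> S" and "finite I"
    and r: "\<And>r. r \<in> tf_rels g I \<Longrightarrow> ev sc B \<phi> r = 0"
  shows "tf_family sc S B g I (\<lambda>i j. \<phi> (T i j)) (\<lambda>c i. \<phi> (Z c i))"
proof -
  note \<phi> [simp]
  have sym: "\<phi> (T i j) = \<phi> (T j i)" if "i \<in> I" "j \<in> I" for i j
  proof -
    have "gen (T i j) - gen (T j i) \<in> tf_rels g I" using that by (intro tf_relsI)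
    from r[OF this] show ?thesis by simp
  qed
  have xy: "B (\<phi> (X a i)) (\<phi> (Y b j)) = (if a = b then \<phi> (T i j) else 0)"
    if "a \<in> {1..g}" "b \<in> {1..g}" "i \<in> I" "j \<in> I" "i \<noteq> j" for a b i j
  proof -
    have "br (gen (X a i)) (gen (Y b j)) - (if a = b then gen (T i j) else 0) \<in> tf_rels g I"
      using that by (intro tf_relsI) auto
    from r[OF this] show ?thesis by (simp split: if_splits)
  qed
  have zz: "B (\<phi> (Z c i)) (\<phi> (Z d j)) = sc (omega c d) (\<phi> (T i j))"
    if cd: "c \<in> cols g" "d \<in> cols g" and ij: "i \<in> I" "j \<in> I" "i \<noteq> j" for c d i j
  proof -
    obtain p a q b where [simp]: "c = (p, a)" "d = (q, b)" by (metis surj_pair)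
    have ab: "a \<in> {1..g}" "b \<in> {1..g}" using cd by (auto simp: cols_def)
    show ?thesis
    proof (cases p; cases q)
      assume pq: "p" "q"
      have "br (gen (X a i)) (gen (X b j)) \<in> tf_rels g I"
        using ab ij by (intro tf_relsI) auto
      from r[OF this] show ?thesis using pq by (simp add: Z_def omega_def)
    next
      assume pq: "\<not> p" "\<not> q"
      have "br (gen (Y a i)) (gen (Y b j)) \<in> tf_rels g I"
        using ab ij by (intro tf_relsI) auto
      from r[OF this] show ?thesis using pq by (simp add: Z_def omega_def)
    next
      assume "p" "\<not> q"
      then show ?thesis using xy[OF ab ij] by (simp add: Z_def omega_def)
    next
      assume "\<not> p" "q"
      \<comment> \<open>The presentation has only [x, y]; antisymmetry gives the sign in
        \<open>omega\<close>, and t_ij = t_ji restores the order of the indices.\<close>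
      then show ?thesis using xy[OF ab(2,1) ij(2,1)] ij sym B_anti[of "\<phi> (Y a i)" "\<phi> (X b j)"]
        by (auto simp add: Z_def omega_def)
    qed
  qed
  show ?thesis
  proof
    fix i j k l assume *: "i \<in> I" "j \<in> I" "k \<in> I" "l \<in> I" "{i, j} \<inter> {k, l} = {}"
    have "br (gen (T i j)) (gen (T k l)) \<in> tf_rels g I"
      using * by (intro tf_relsI)
    from r[OF this] show "B (\<phi> (T i j)) (\<phi> (T k l)) = 0" by simp
  next
    fix i j k assume *: "i \<in> I" "j \<in> I" "k \<in> I" "k \<notin> {i, j}"
    have "br (gen (T i j)) (gen (T i k) + gen (T j k)) \<in> tf_rels g I"
      using * by (intro tf_relsI)
    from r[OF this] show "B (\<phi> (T i j)) (\<phi> (T i k) + \<phi> (T j k)) = 0" by simp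
  next
    fix c i j k assume *: "c \<in> cols g" "i \<in> I" "j \<in> I" "k \<in> I" "k \<notin> {i, j}"
    have "br (gen (Z c k)) (gen (T i j)) \<in> tf_rels g I"
      using * by (cases c; cases "fst c") (auto simp: Z_def cols_def intro!: tf_relsI)
    from r[OF this] show "B (\<phi> (Z c k)) (\<phi> (T i j)) = 0" by simp
  next
    fix c i j assume *: "c \<in> cols g" "i \<in> I" "j \<in> I"
    have "br (gen (Z c i) + gen (Z c j)) (gen (T i j)) \<in> tf_rels g I"
      using * by (cases c; cases "fst c") (auto simp: Z_def cols_def intro!: tf_relsI)
    from r[OF this] show "B (\<phi> (Z c i) + \<phi> (Z c j)) (\<phi> (T i j)) = 0" by simp
  next
    fix i assume *: "i \<in> I"
    have "(\<Sum>a\<in>{1..g}. br (gen (X a i)) (gen (Y a i)))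
        + (\<Sum>j\<in>I - {i}. gen (T i j)) - msmult (of_nat g - 1) (gen (T i i)) \<in> tf_rels g I"
      using * by (intro tf_relsI)
    from r[OF this] show "(\<Sum>a\<in>{1..g}. B (\<phi> (Z (True, a) i)) (\<phi> (Z (False, a) i))) +
      (\<Sum>j\<in>I - {i}. \<phi> (T i j)) = sc (of_nat g - 1) (\<phi> (T i i))" by (simp add: Z_def)
  qed (use \<open>finite I\<close> sym zz in simp_all)
qed

section \<open>Consequences of the relations after division by 2\<close>

locale tf_family_char_0 = tf_family sc S B g I t z
  for sc :: "'k::field_char_0 \<Rightarrow> 'a::ab_group_add \<Rightarrow> 'a" and S B g
    and I :: "'i set" and t z
begin

lemma double_eq_0: "x + x = 0 \<Longrightarrow> x = (0 :: 'a)"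
proof -
  assume "x + x = 0"
  then have "sc 2 x = 0" using scale_left_distrib[of 1 1 x] by simp
  then show ?thesis by simp
qed

text \<open>For \<open>k = i\<close> the relation [z_i + z_j, t_ij] = 0 with j = i reads 2
  [z_i, t_ii] = 0.\<close>

lemma z_t_diag: "c \<in> cols g \<Longrightarrow> i \<in> I \<Longrightarrow> k \<in> I \<Longrightarrow> B (z c k) (t i i) = 0"
  using z_t[of c i i k] z_add_t[of c i i] double_eq_0[of "B (z c i) (t i i)"]
  by (cases "k = i") (simp_all add: B_bilinear)

text \<open>The triangle relation with j = i reads 2 [t_ii, t_ik] = 0; all remaining cases have
  disjoint indices or coincide.\<close>

lemma t_t_diag: "i \<in> I \<Longrightarrow> k \<in> I \<Longrightarrow> l \<in> I \<Longrightarrow> B (t k l) (t i i) = 0"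
proof -
  have *: "B (t i k) (t i i) = 0" if "i \<in> I" "k \<in> I" for k
  proof (cases "k = i")
    case False
    then have "B (t i i) (t i k) = 0"
      using t_triangle[of i i k] double_eq_0[of "B (t i i) (t i k)"] that by (simp add: B_bilinear)
    then show ?thesis using B_anti[of "t i i" "t i k"] that by simp
  qed (use that in \<open>simp add: B_self\<close>)
  show "i \<in> I \<Longrightarrow> k \<in> I \<Longrightarrow> l \<in> I \<Longrightarrow> B (t k l) (t i i) = 0"
    using *[of l] *[of k] t_sym[of k l] t_disjoint[of k l i i] by (cases "k = i"; cases "l
        = i") auto
qed

lemma diag_t: "i \<in> I \<Longrightarrow> k \<in> I \<Longrightarrow> l \<in> I \<Longrightarrow> B (t i i) (t k l) = 0"
  and diag_z: "c \<in> cols g \<Longrightarrow> i \<in> I \<Longrightarrow> k \<in> I \<Longrightarrow> B (t i i) (z c k) = 0"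
  using t_t_diag[of i k l] B_anti[of "t i i" "t k l"] z_t_diag[of c i k] B_anti[of "t i i" "z c k"]
  by simp_all

lemma t_z: "c \<in> cols g \<Longrightarrow> i \<in> I \<Longrightarrow> j \<in> I \<Longrightarrow> k \<in> I \<Longrightarrow> k \<notin> {i, j} \<Longrightarrow> B (t i j) (z c k) = 0"
  using z_t[of c i j k] B_anti[of "t i j" "z c k"] by simp

text \<open>Writes a bracket with one factor on the strand \<open>k\<close> as a bracket of two
  elements on that strand. This is what makes the elements on one strand generate an ideal, and it
  is the source of the formula for the derivations by t_ij.\<close>

lemma t_t_common:
  assumes "i \<in> I" "j \<in> I" "k \<in> I" "k \<noteq> i" "k \<noteq> j"
  shows "B (t i j) (t i k) = B (t i k) (t j k)"
proof (cases "i = j")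
  case False
  then have "B (t i k) (t i j) + B (t i k) (t j k) = 0"
    using t_triangle[of i k j] t_sym[of j k] assms by (simp add: B_bilinear)
  then show ?thesis
    using B_anti[of "t i j" "t i k"] assms by (simp add: neg_eq_iff_add_eq_0)
qed (use assms diag_t[of i i k] B_self[of "t i k"] in simp)

end

section \<open>Doubling a strand, adding a zero strand, brackets with one strand\<close>

text \<open>The strand \<open>o1\<close> is replaced by the sum of \<open>o1\<close> and
  \<open>s\<close>: t'_ij is the sum of all t_kl with k over i and l over j. Most relations follow
  by bilinearity from those of the single strands, the mixed terms having disjoint indices.\<close>

lemma (in tf_family_char_0) tf_family_double:
  assumes I: "I = insert s J" "s \<notin> J" and o: "o1 \<in> J"
  defines "t' \<equiv> \<lambda>i j. t i j + (if j = o1 then t i s else 0) + (if i = o1 then t s j else 0)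
      + (if i = o1 \<and> j = o1 then t s s else 0)"
    and "z' \<equiv> \<lambda>c i. z c i + (if i = o1 then z c s else 0)"
  shows "tf_family sc S B g J t' z'"
proof
  have sub [simp]: "i \<in> J \<Longrightarrow> i \<in> I" "s \<in> I" "i \<in> J \<Longrightarrow> i \<noteq> s" "i \<in> J \<Longrightarrow> s \<noteq> i" for i
    using I by auto
  note [simp] = o
  have s_o: "t s o1 = t o1 s" using t_sym[of s o1] by simp
  show "finite J" using finite_index I by auto
  show "t' i j \<in> S" if "i \<in> J" "j \<in> J" for i j using that by (simp add: t'_def)
  show "z' c i \<in> S" if "c \<in> cols g" "i \<in> J" for c i using that by (simp add: z'_def)
  show "t' i j = t' j i" if "i \<in> J" "j \<in> J" for i j
    using that t_sym[of i j] t_sym[of s i] t_sym[of s j] t_sym[of s s]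
    by (auto simp add: t'_def algebra_simps)
  show "B (t' i j) (t' k l) = 0"
    if "i \<in> J" "j \<in> J" "k \<in> J" "l \<in> J" "{i, j} \<inter> {k, l} = {}" for i j k l
    using that by (auto simp: t'_def B_bilinear t_disjoint)
  show "B (t' i j) (t' i k + t' j k) = 0" if tri: "i \<in> J" "j \<in> J" "k \<in> J" "k \<notin> {i, j}" for i j k
  proof -
    consider "i \<noteq> o1" "j \<noteq> o1" "k \<noteq> o1" | "k = o1" "i \<noteq> o1" "j \<noteq> o1" | "i = o1" "j \<noteq> o1" "k \<noteq> o1"
      | "j = o1" "i \<noteq> o1" "k \<noteq> o1" | "i = o1" "j = o1" "k \<noteq> o1"
      using tri by auto
    then show ?thesis
    proof cases
      case 1 then show ?thesis using tri t_triangle[of i j k] by (simp add: t'_def)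
    next
      case 2
      then have "B (t' i j) (t' i k + t' j k) = B (t i j) (t i o1 + t j o1) + B (t i j) (t i s
          + t j s)"
        using tri by (simp add: t'_def B_bilinear algebra_simps)
      then show ?thesis using tri 2 t_triangle[of i j o1] t_triangle[of i j s] by simp
    next
      case 3
      then have "B (t' i j) (t' i k + t' j k) =
        B (t o1 j) (t o1 k + t j k) + B (t s j) (t s k + t j k) + B (t o1 j) (t s k)
            + B (t s j) (t o1 k)"
        using tri by (simp add: t'_def B_bilinear algebra_simps)
      then show ?thesis using tri 3 t_triangle[of o1 j k] t_triangle[of s j k] t_disjoint by simp
    next
      case 4
      then have "B (t' i j) (t' i k + t' j k) =
        B (t i o1) (t i k + t o1 k) + B (t i s) (t i k + t s k) + B (t i o1) (t s k)
            + B (t i s) (t o1 k)"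
        using tri by (simp add: t'_def B_bilinear algebra_simps)
      then show ?thesis using tri 4 t_triangle[of i o1 k] t_triangle[of i s k] t_disjoint by simp
    next
      case 5
      \<comment> \<open>Up to the central diagonal elements t'_{o1 o1} is 2 t_{o1 s}, so the
        triangle on \<open>o1\<close>, \<open>s\<close>, \<open>k\<close> is what remains.\<close>
      have "B (t o1 s) (t o1 k) + B (t o1 s) (t s k) = 0"
        using t_triangle[of o1 s k] that 5 by (simp add: B_bilinear)
      then have "B (t o1 s) (t s k) = - B (t o1 s) (t o1 k)"
          by (simp add: eq_neg_iff_add_eq_0 add.commute)
      then show ?thesis using tri 5 by (simp add: t'_def B_bilinear diag_t s_o)
    qed
  qed
  show "B (z' c i) (z' d j) = sc (omega c d) (t' i j)"
    if "c \<in> cols g" "d \<in> cols g" "i \<in> J" "j \<in> J" "i \<noteq> j" for c d i j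
    using that by (auto simp: z'_def t'_def B_bilinear z_z scale_right_distrib)
  show "B (z' c k) (t' i j) = 0" if "c \<in> cols g" "i \<in> J" "j \<in> J" "k \<in> J" "k \<notin> {i, j}" for c i j k
    using that by (auto simp: z'_def t'_def B_bilinear z_t)
  show "B (z' c i + z' c j) (t' i j) = 0" if "c \<in> cols g" "i \<in> J" "j \<in> J" for c i j
  proof -
    consider "i \<noteq> o1" "j \<noteq> o1" | "i = o1" "j \<noteq> o1" | "j = o1" "i \<noteq> o1" | "i = o1" "j = o1"
      by auto
    then show ?thesis
    proof cases
      case 1 then show ?thesis using that z_add_t[of c i j] by (simp add: z'_def t'_def)
    next
      case 2
      then have "B (z' c i + z' c j) (t' i j) =
        B (z c o1 + z c j) (t o1 j) + B (z c s + z c j) (t s j) + B (z c o1) (t s j)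
            + B (z c s) (t o1 j)"
        using that by (simp add: t'_def z'_def B_bilinear algebra_simps)
      then show ?thesis using that 2 z_add_t[of c o1 j] z_add_t[of c s j] by (simp add: z_t)
    next
      case 3
      then have "B (z' c i + z' c j) (t' i j) =
        B (z c i + z c o1) (t i o1) + B (z c i + z c s) (t i s) + B (z c o1) (t i s)
            + B (z c s) (t i o1)"
        using that by (simp add: t'_def z'_def B_bilinear algebra_simps)
      then show ?thesis using that 3 z_add_t[of c i o1] z_add_t[of c i s] by (simp add: z_t)
    next
      case 4
      have "B (z c o1) (t o1 s) + B (z c s) (t o1 s) = 0"
        using z_add_t[of c o1 s] that by (simp add: B_bilinear)
      then have "B (z c o1) (t o1 s) = - B (z c s) (t o1 s)" by (simp add: eq_neg_iff_add_eq_0)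
      then show ?thesis using that 4 by (simp add: z'_def t'_def B_bilinear z_t_diag s_o)
    qed
  qed
  show "(\<Sum>a\<in>{1..g}. B (z' (True, a) i) (z' (False, a) i)) + (\<Sum>j\<in>J - {i}. t' i j) =
      sc (of_nat g - 1) (t' i i)" if "i \<in> J" for i
  proof -
    have fin: "finite (J - {i})" using finite_index I by auto
    have I_i: "I - {i} = insert s (J - {i})" and I_s: "I - {s} = J"
      using I that by auto
    have sum_i: "(\<Sum>j\<in>I - {i}. t i j) = t i s + (\<Sum>j\<in>J - {i}. t i j)"
      unfolding I_i using fin I by simp
    show ?thesis
    proof (cases "i = o1")
      case False
      have "(\<Sum>j\<in>J - {i}. t' i j) = (\<Sum>j\<in>J - {i}. t i j + (if j = o1 then t i s else 0))"
        using False by (simp add: t'_def)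
      also have "\<dots> = (\<Sum>j\<in>J - {i}. t i j) + t i s"
        using fin False by (simp add: sum.distrib)
      finally have "(\<Sum>j\<in>J - {i}. t' i j) = (\<Sum>j\<in>I - {i}. t i j)" by (simp add: sum_i)
      then show ?thesis using z_sum[of i] that False by (simp add: z'_def t'_def)
    next
      case True
      have sum_s: "(\<Sum>j\<in>I - {s}. t s j) = t o1 s + (\<Sum>j\<in>J - {o1}. t s j)"
        unfolding I_s using finite_index I o by (simp add: sum.remove[OF _ o] s_o)
      have "(\<Sum>j\<in>J - {o1}. t' o1 j) = (\<Sum>j\<in>J - {o1}. t o1 j + t s j)"
        by (rule sum.cong) (auto simp: t'_def)
      then have ts: "(\<Sum>j\<in>J - {o1}. t' o1 j) = (\<Sum>j\<in>J - {o1}. t o1 j) + (\<Sum>j\<in>J - {o1}. t s j)"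
        by (simp add: sum.distrib)
      \<comment> \<open>The cross terms contribute 2 g t_{o1 s} in total. The relations for
        \<open>o1\<close> and \<open>s\<close> subtract t_{o1 s} once each, which leaves (g - 1) 2
        t_{o1 s}: exactly the mixed part of (g - 1) t'_{o1 o1}.\<close>
      have "B (z' (True, a) o1) (z' (False, a) o1) =
        B (z (True, a) o1) (z (False, a) o1) + B (z (True, a) s) (z (False, a) s) + (t o1 s
            + t o1 s)"
        if "a \<in> {1..g}" for a
        using that by (simp add: z'_def B_bilinear cols_def z_z omega_def s_o algebra_simps)
      then have "(\<Sum>a\<in>{1..g}. B (z' (True, a) o1) (z' (False, a) o1)) =
        (\<Sum>a\<in>{1..g}. B (z (True, a) o1) (z (False, a) o1)) + (\<Sum>a\<in>{1..g}. B (z (True,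
            a) s) (z (False, a) s))
        + sc (of_nat g) (t o1 s + t o1 s)"
        using sum_constant_scale[of "t o1 s + t o1 s" "{1..g}"]
        by (simp add: sum.distrib)
      moreover have "(\<Sum>a\<in>{1..g}. B (z (True, a) o1) (z (False, a) o1)) =
          sc (of_nat g - 1) (t o1 o1) - (t o1 s + (\<Sum>j\<in>J - {o1}. t o1 j))"
        using z_sum[of o1] sum_i[unfolded True] by (simp add: eq_diff_eq)
      moreover have "(\<Sum>a\<in>{1..g}. B (z (True, a) s) (z (False, a) s)) =
          sc (of_nat g - 1) (t s s) - (t o1 s + (\<Sum>j\<in>J - {o1}. t s j))"
        using z_sum[of s] sum_s by (simp add: eq_diff_eq)
      ultimately show ?thesis
        unfolding True ts by (simp only:) (simp add: t'_def s_o algebra_simps)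
    qed
  qed
qed

text \<open>The family behind epsilon^*: a bracket relation on the new strand has a zero factor, and
  the sums in the last relation only gain zero summands.\<close>

lemma (in tf_family) tf_family_extend_by_zero:
  assumes s: "s \<notin> I"
  shows "tf_family sc S B g (insert s I) (\<lambda>i j. if i = s \<or> j = s then 0 else t i j)
    (\<lambda>c i. if i = s then 0 else z c i)"
proof
  fix i assume "i \<in> insert s I"
  then show "(\<Sum>a\<in>{1..g}. B (if i = s then 0 else z (True, a) i) (if i = s then 0 else z (False,
      a) i)) +
      (\<Sum>j\<in>insert s I - {i}. if i = s \<or> j = s then 0 else t i j) =
      sc (of_nat g - 1) (if i = s \<or> i = s then 0 else t i i)"
  proof
    assume i: "i \<in> I"
    then have "(\<Sum>j\<in>insert s I - {i}. if i = s \<or> j = s then 0 else t i j) = (\<Sum>j\<in>I - {i}. t i j)"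
      using s finite_index by (intro sum.mono_neutral_cong_right) auto
    then show ?thesis using z_sum[OF i] s i by auto
  qed simp
next
  fix i j k assume *: "i \<in> insert s I" "j \<in> insert s I" "k \<in> insert s I" "k \<notin> {i, j}"
  then show "B (if i = s \<or> j = s then 0 else t i j)
      ((if i = s \<or> k = s then 0 else t i k) + (if j = s \<or> k = s then 0 else t j k)) = 0"
    using t_triangle[of i j k] by auto
next
  fix c i j assume "c \<in> cols g" "i \<in> insert s I" "j \<in> insert s I"
  then show "B ((if i = s then 0 else z c i) + (if j = s then 0 else z c j))
      (if i = s \<or> j = s then 0 else t i j) = 0"
    using z_add_t[of c i j] by auto
qed (use finite_index t_sym in \<open>auto simp: t_disjoint z_z z_t\<close>)

text \<open>\<open>U\<close> is only a subalgebra containing the generators of u. Each bracket of a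
  generator with an element on the strand \<open>s\<close> vanishes, is a multiple of some t_is, or
  can be rewritten as a bracket of two elements on \<open>s\<close>; hence \<open>U\<close> absorbs
  generators.\<close>

lemma (in tf_family_char_0) ideal_step:
  assumes I: "I = insert s J" "s \<notin> J" and o: "o1 \<in> J"
    and U: "subspace U" "\<And>x y. x \<in> U \<Longrightarrow> y \<in> U \<Longrightarrow> B x y \<in> U"
    and z_U: "\<And>c. c \<in> cols g \<Longrightarrow> z c s \<in> U"
    and t_U: "\<And>j. j \<in> J \<Longrightarrow> j \<noteq> o1 \<Longrightarrow> t j s \<in> U"
    and s_U: "t s s \<in> U"
  shows "i \<in> I \<Longrightarrow> t i s \<in> U"
    and "i \<in> I \<Longrightarrow> j \<in> I \<Longrightarrow> k \<in> I \<Longrightarrow> B (t i j) (t k s) \<in> U"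
    and "i \<in> I \<Longrightarrow> j \<in> I \<Longrightarrow> d \<in> cols g \<Longrightarrow> B (t i j) (z d s) \<in> U"
    and "c \<in> cols g \<Longrightarrow> i \<in> I \<Longrightarrow> k \<in> I \<Longrightarrow> B (z c i) (t k s) \<in> U"
    and "c \<in> cols g \<Longrightarrow> i \<in> I \<Longrightarrow> d \<in> cols g \<Longrightarrow> B (z c i) (z d s) \<in> U"
proof -
  have sI: "s \<in> I" and oI: "o1 \<in> I" "o1 \<noteq> s" using I o by auto
  have "I - {s} = J" "finite J" using I finite_index by auto
  then have "(\<Sum>j\<in>I - {s}. t s j) = t s o1 + (\<Sum>j\<in>J - {o1}. t s j)"
    using o by (simp add: sum.remove)
  \<comment> \<open>The last relation for the strand \<open>s\<close> is solved for the one element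
    t_{s o1} that is not assumed to lie in \<open>U\<close>.\<close>
  then have "t s o1 = sc (of_nat g - 1) (t s s) - (\<Sum>j\<in>J - {o1}. t s j)
      - (\<Sum>a\<in>{1..g}. B (z (True, a) s) (z (False, a) s))"
    using z_sum[OF sI] by (simp add: algebra_simps)
  moreover have "t s j \<in> U" if "j \<in> J - {o1}" for j
    using t_U[of j] t_sym[of s j] that I by auto
  moreover have "B (z (True, a) s) (z (False, a) s) \<in> U" if "a \<in> {1..g}" for a
    using that by (intro U z_U) (auto simp: cols_def)
  ultimately have "t s o1 \<in> U"
    by (auto intro!: subspace_diff[OF U(1)] subspace_scale[OF U(1)] subspace_sum[OF U(1)] s_U)
  then have t_s: "t i s \<in> U" if "i \<in> I" for i
    using that t_U[of i] s_U t_sym[of o1 s] oI sI I by (cases "i = o1"; cases "i = s") auto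
  then show "i \<in> I \<Longrightarrow> t i s \<in> U" .
  have s_t: "t s i \<in> U" if "i \<in> I" for i using t_s[OF that] t_sym[of i s] that sI by simp
  show "B (t i j) (t k s) \<in> U" if "i \<in> I" "j \<in> I" "k \<in> I" for i j k
  proof -
    consider "i = s \<or> j = s \<or> k = s" | "i = j" "j \<noteq> s" | "k \<noteq> s" "k \<notin> {i, j}" "i \<noteq> s" "j \<noteq> s"
      | "i \<noteq> s" "j \<noteq> s" "i \<noteq> j" "k = i" | "i \<noteq> s" "j \<noteq> s" "i \<noteq> j" "k = j" by auto
    then show ?thesis
    proof cases
      case 1
      then show ?thesis
        using that sI t_s s_t U t_t_diag[of s i j] by (auto simp: subspace_0)
    next
      case 2 then show ?thesis using diag_t[of i k s] that sI U by (simp add: subspace_0)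
    next
      case 3 then show ?thesis using t_disjoint[of i j k s] that sI U by (simp add: subspace_0)
    next
      case 4
      then have "B (t i j) (t k s) = B (t i s) (t j s)" using t_t_common[of i j s] that sI by simp
      then show ?thesis using U t_s that by simp
    next
      case 5
      then have "B (t i j) (t k s) = B (t j s) (t i s)"
        using t_t_common[of j i s] that sI t_sym[of i j] by simp
      then show ?thesis using U t_s that by simp
    qed
  qed
  show "B (t i j) (z d s) \<in> U" if "i \<in> I" "j \<in> I" "d \<in> cols g" for i j d
  proof (cases "s \<in> {i, j}")
    case True
    then have "t i j \<in> U" using that t_s s_t by auto
    then show ?thesis using that z_U U by blast
  qed (use that sI U t_z[of d i j s] in \<open>auto simp: subspace_0\<close>)
  show "B (z c i) (t k s) \<in> U" if "c \<in> cols g" "i \<in> I" "k \<in> I" for c i k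
  proof -
    consider "i = s" | "k = s" | "i \<noteq> s" "k \<noteq> s" "k \<noteq> i" | "i \<noteq> s" "k = i" by auto
    then show ?thesis
    proof cases
      case 1 then show ?thesis using that z_U t_s U by simp
    next
      case 2 then show ?thesis using that z_t_diag[of c s i] sI U by (simp add: subspace_0)
    next
      case 3 then show ?thesis using that z_t[of c k s i] sI U by (simp add: subspace_0)
    next
      case 4
      then have "B (z c i) (t k s) = - B (z c s) (t i s)"
        using z_add_t[of c i s] that sI by (simp add: B_bilinear eq_neg_iff_add_eq_0)
      then show ?thesis using that z_U t_s U by (simp add: subspace_neg)
    qed
  qed
  show "B (z c i) (z d s) \<in> U" if "c \<in> cols g" "i \<in> I" "d \<in> cols g" for c i d
    using that sI t_s z_U U z_z[of c d i s] by (cases "i = s") (auto simp: subspace_scale)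
qed

section \<open>The extension of a Lie algebra by derivations\<close>

text \<open>A pair (v, E) encodes the element v + D of the semidirect product with the derivations, where
  E = ad v + D records the resulting action on the Lie algebra.\<close>

locale derivation_extension = lie_on sc UNIV B
  for sc :: "'k::field \<Rightarrow> 'a::ab_group_add \<Rightarrow> 'a" and B +
  fixes Der :: "('a \<Rightarrow> 'a) set"
  assumes Der_add: "E \<in> Der \<Longrightarrow> E (u + v) = E u + E v"
    and Der_scale: "E \<in> Der \<Longrightarrow> E (sc c u) = sc c (E u)"
    and Der_B: "E \<in> Der \<Longrightarrow> E (B u v) = B (E u) v + B u (E v)"
    and Der_zero_closed: "0 \<in> Der"
    and Der_add_closed: "E \<in> Der \<Longrightarrow> F \<in> Der \<Longrightarrow> E + F \<in> Der"
    and Der_scale_closed: "E \<in> Der \<Longrightarrow> (\<lambda>w. sc c (E w)) \<in> Der"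
    and Der_commutator_closed: "E \<in> Der \<Longrightarrow> F \<in> Der \<Longrightarrow> (\<lambda>w. E (F w) - F (E w)) \<in> Der"
    and Der_ad: "B v \<in> Der"
begin

lemma Der_0: "E \<in> Der \<Longrightarrow> E 0 = 0"
  using Der_scale[of E 0 0] by simp

lemma Der_minus: "E \<in> Der \<Longrightarrow> E (- u) = - E u"
  using Der_scale[of E "- 1" u] by simp

lemma Der_diff: "E \<in> Der \<Longrightarrow> E (u - v) = E u - E v"
  using Der_add[of E u "- v"] by (simp add: Der_minus)

lemma Der_sum: "E \<in> Der \<Longrightarrow> E (sum f A) = (\<Sum>i\<in>A. E (f i))"
  by (induction A rule: infinite_finite_induct) (simp_all add: Der_add Der_0)

lemmas Der_linear = Der_add Der_scale Der_0 Der_minus Der_diff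

definition psc :: "'k \<Rightarrow> 'a \<times> ('a \<Rightarrow> 'a) \<Rightarrow> 'a \<times> ('a \<Rightarrow> 'a)" where
  "psc c p = (sc c (fst p), \<lambda>w. sc c (snd p w))"

text \<open>The bracket [v, v'] + D v' - D' v + [D, D'] of the semidirect product, rewritten with D
  = E - ad v and D' = E' - ad v'. The second component is a plain commutator because v + D acts by
  ad v + D.\<close>

definition pbr :: "'a \<times> ('a \<Rightarrow> 'a) \<Rightarrow> 'a \<times> ('a \<Rightarrow> 'a) \<Rightarrow> 'a \<times> ('a \<Rightarrow> 'a)" where
  "pbr p q = (snd p (fst q) - snd q (fst p) - B (fst p) (fst q),
    \<lambda>w. snd p (snd q w) - snd q (snd p w))"

definition pS :: "('a \<times> ('a \<Rightarrow> 'a)) set" where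
  "pS = UNIV \<times> Der"

lemma fst_psc [simp]: "fst (psc c p) = sc c (fst p)"
  and snd_psc [simp]: "snd (psc c p) w = sc c (snd p w)"
  and fst_pbr [simp]: "fst (pbr p q) = snd p (fst q) - snd q (fst p) - B (fst p) (fst q)"
  and snd_pbr [simp]: "snd (pbr p q) w = snd p (snd q w) - snd q (snd p w)"
  by (simp_all add: psc_def pbr_def)

lemma vector_space_psc: "vector_space psc"
  by unfold_locales
    (auto simp: prod_eq_iff fun_eq_iff fun_ops scale_right_distrib scale_left_distrib)

lemma snd_pS: "p \<in> pS \<Longrightarrow> snd p \<in> Der"
  by (auto simp: pS_def)

lemma lie_on_pairs: "lie_on psc pS pbr"
proof -
  interpret p: vector_space psc by (rule vector_space_psc)
  note D = Der_linear[OF snd_pS] Der_B[OF snd_pS]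
  show ?thesis
  proof unfold_locales
    show "p.subspace pS"
      by (rule p.subspaceI)
        (auto simp: pS_def psc_def zero_prod_def Der_zero_closed Der_add_closed Der_scale_closed)
    fix x y z :: "'a \<times> ('a \<Rightarrow> 'a)" and c
    assume x: "x \<in> pS" and y: "y \<in> pS"
    show "pbr x y \<in> pS"
      using x y by (auto simp: pS_def pbr_def Der_commutator_closed)
    show "pbr (psc c x) y = psc c (pbr x y)" "pbr x (psc c y) = psc c (pbr x y)"
      by (auto simp: prod_eq_iff fun_eq_iff D x y B_bilinear scale_right_diff_distrib)
    show "pbr x x = 0"
      by (simp add: prod_eq_iff fun_eq_iff fun_ops B_self)
    assume z: "z \<in> pS"
    show "pbr (x + y) z = pbr x z + pbr y z" "pbr x (y + z) = pbr x y + pbr x z"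
      by (auto simp: prod_eq_iff fun_eq_iff fun_ops D x y z B_bilinear)
    \<comment> \<open>The second component satisfies Jacobi as a commutator of maps. In the first,
      the terms with one derivation occur in both orders and cancel after these rewritings; one
      Jacobi identity of \<open>B\<close> remains.\<close>
    have "B (fst x) (snd z (fst y)) = - B (snd z (fst y)) (fst x)"
      "B (fst y) (snd x (fst z)) = - B (snd x (fst z)) (fst y)"
      "B (fst z) (snd y (fst x)) = - B (snd y (fst x)) (fst z)"
      "B (fst x) (snd y (fst z)) = - B (snd y (fst z)) (fst x)"
      "B (fst y) (snd z (fst x)) = - B (snd z (fst x)) (fst y)"
      "B (fst z) (snd x (fst y)) = - B (snd x (fst y)) (fst z)"
      by (rule B_anti; simp)+
    moreover have "B (fst x) (B (fst y) (fst z)) =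
      - B (fst y) (B (fst z) (fst x)) - B (fst z) (B (fst x) (fst y))"
      using B_jacobi[of "fst x" "fst y" "fst z"] by (simp add: algebra_simps eq_neg_iff_add_eq_0)
    ultimately show "pbr x (pbr y z) + pbr y (pbr z x) + pbr z (pbr x y) = 0"
      by (simp add: prod_eq_iff fun_eq_iff fun_ops D x y z B_bilinear)
  qed
qed

sublocale pair: lie_on psc pS pbr
  by (rule lie_on_pairs)

definition inn :: "'a \<Rightarrow> 'a \<times> ('a \<Rightarrow> 'a)" where
  "inn v = (v, B v)"

lemma fst_inn [simp]: "fst (inn v) = v"
  and snd_inn [simp]: "snd (inn v) = B v"
  by (simp_all add: inn_def)

lemma inn_closed [simp]: "inn v \<in> pS"
  by (simp add: inn_def pS_def Der_ad)

lemma inn_linear: "inn (u + v) = inn u + inn v" "inn (u - v) = inn u - inn v" "inn (- u) = - inn u"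
    "inn (sc c u) = psc c (inn u)" "inn 0 = 0"
  by (simp_all add: prod_eq_iff fun_eq_iff fun_ops B_bilinear)

lemma inn_sum: "inn (sum f A) = (\<Sum>i\<in>A. inn (f i))"
  by (induction A rule: infinite_finite_induct) (simp_all add: inn_linear)

text \<open>The second component already contains ad of the first, so bracketing with an element of
  the Lie algebra is mere application.\<close>

lemma pbr_inn_right: "p \<in> pS \<Longrightarrow> pbr p (inn w) = inn (snd p w)"
  using B_anti[of w "fst p"]
  by (simp add: prod_eq_iff fun_eq_iff Der_B[OF snd_pS])

lemma pbr_inn_left: "p \<in> pS \<Longrightarrow> pbr (inn w) p = inn (- snd p w)"
  using pair.B_anti[of "inn w" p] by (simp add: pbr_inn_right inn_linear)

end

section \<open>The action on the kernel\<close>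

text \<open>Here \<open>a i\<close>, \<open>x c\<close>, \<open>c0\<close> play the roles of t_{i*},
  the x and y on the strand \<open>Star\<close>, and t_{**}; \<open>Et i j\<close> and
  \<open>Ex c i\<close> those of ad t_ij and ad z_ci on u. Their values are the brackets forced in
  the framed Lie algebra, for example [t_ij, t_{i*}] = [t_{i*}, t_{j*}].\<close>

locale strand_action = derivation_extension sc B Der
  for sc :: "'k::field \<Rightarrow> 'a::ab_group_add \<Rightarrow> 'a" and B and Der +
  fixes g :: nat and J :: "'i set" and o1 s :: 'i
    and a :: "'i \<Rightarrow> 'a" and x :: "bool \<times> nat \<Rightarrow> 'a" and c0 :: 'a
    and Et :: "'i \<Rightarrow> 'i \<Rightarrow> 'a \<Rightarrow> 'a" and Ex :: "bool \<times> nat \<Rightarrow> 'i \<Rightarrow> 'a \<Rightarrow> 'a"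
  assumes finite_J: "finite J" and o1: "o1 \<in> J" and s: "s \<notin> J"
    and ext: "E \<in> Der \<Longrightarrow> (\<And>c. c \<in> cols g \<Longrightarrow> E (x c) = 0) \<Longrightarrow>
      (\<And>k. k \<in> J \<Longrightarrow> E (a k) = 0) \<Longrightarrow> E c0 = 0 \<Longrightarrow> E = 0"
    and central: "B c0 w = 0"
    and sum_a: "(\<Sum>b\<in>{1..g}. B (x (True, b)) (x (False, b))) + sum a J = sc (of_nat g - 1) c0"
    and Et_Der: "i \<in> J \<Longrightarrow> j \<in> J \<Longrightarrow> Et i j \<in> Der"
    and Ex_Der: "c \<in> cols g \<Longrightarrow> i \<in> J \<Longrightarrow> Ex c i \<in> Der"
    and Et_x: "i \<in> J \<Longrightarrow> j \<in> J \<Longrightarrow> d \<in> cols g \<Longrightarrow> Et i j (x d) = 0"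
    and Et_a: "i \<in> J \<Longrightarrow> j \<in> J \<Longrightarrow> k \<in> J \<Longrightarrow> Et i j (a k) =
      (if k = i then B (a i) (a j) else 0) + (if k = j then B (a j) (a i) else 0)"
    and Et_c0: "i \<in> J \<Longrightarrow> j \<in> J \<Longrightarrow> Et i j c0 = 0"
    and Ex_x: "c \<in> cols g \<Longrightarrow> i \<in> J \<Longrightarrow> d \<in> cols g \<Longrightarrow> Ex c i (x d) = sc (omega c d) (a i)"
    and Ex_a: "c \<in> cols g \<Longrightarrow> i \<in> J \<Longrightarrow> k \<in> J \<Longrightarrow> Ex c i (a k) = (if k = i then B (a i) (x c) else 0)"
    and Ex_c0: "c \<in> cols g \<Longrightarrow> i \<in> J \<Longrightarrow> Ex c i c0 = 0"
begin

text \<open>With primes for images under the splitting, t_{i o1} = t'_{i o1} - t_is and t_{o1 o1} =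
  t'_{o1 o1} - 2 t_{o1 s} - t_ss. Primed elements have no component in u, so the first components
  below are forced; \<open>eps\<close> merges these cases into one formula.\<close>

definition eps :: "'i \<Rightarrow> 'k" where
  "eps i = (if i = o1 then - 1 else 0)"

text \<open>Under the splitting the sum of the strands o1 and s is a pure derivation; so the first
  component of a generator on the strand o1 is minus the generator on the strand s.\<close>

definition pt :: "'i \<Rightarrow> 'i \<Rightarrow> 'a \<times> ('a \<Rightarrow> 'a)" where
  "pt i j = (sc (eps i) (a j) + sc (eps j) (a i) - sc (eps i * eps j) c0, Et i j)"

definition px :: "bool \<times> nat \<Rightarrow> 'i \<Rightarrow> 'a \<times> ('a \<Rightarrow> 'a)" where
  "px c i = (sc (eps i) (x c), Ex c i)"

definition ft :: "'i \<Rightarrow> 'i \<Rightarrow> 'a \<times> ('a \<Rightarrow> 'a)" where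
  "ft i j = (if i = s then if j = s then inn c0 else inn (a j)
    else if j = s then inn (a i) else pt i j)"

definition fx :: "bool \<times> nat \<Rightarrow> 'i \<Rightarrow> 'a \<times> ('a \<Rightarrow> 'a)" where
  "fx c i = (if i = s then inn (x c) else px c i)"

lemma fst_pt: "fst (pt i j) = sc (eps i) (a j) + sc (eps j) (a i) - sc (eps i * eps j) c0"
  and snd_pt [simp]: "snd (pt i j) = Et i j"
  and fst_px: "fst (px c i) = sc (eps i) (x c)"
  and snd_px [simp]: "snd (px c i) = Ex c i"
  by (simp_all add: pt_def px_def)

lemma pt_closed [simp]: "i \<in> J \<Longrightarrow> j \<in> J \<Longrightarrow> pt i j \<in> pS"
  and px_closed [simp]: "c \<in> cols g \<Longrightarrow> i \<in> J \<Longrightarrow> px c i \<in> pS"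
  by (simp_all add: pt_def px_def pS_def Et_Der Ex_Der)

lemma central': "B w c0 = 0"
  using B_anti[of w c0] central by simp

text \<open>Reduces each relation to finitely many identities in the Lie algebra: one for the first
  component, the others for the derivation on generators.\<close>

lemma pair_eq_0:
  assumes "p \<in> pS" "fst p = 0" "\<And>c. c \<in> cols g \<Longrightarrow> snd p (x c) = 0"
    "\<And>k. k \<in> J \<Longrightarrow> snd p (a k) = 0" "snd p c0 = 0"
  shows "p = 0"
  using assms ext[of "snd p"] by (simp add: prod_eq_iff snd_pS)

lemmas E_simps = Et_x Et_a Et_c0 Ex_x Ex_a Ex_c0
lemmas E_linear = Der_linear[OF Et_Der] Der_linear[OF Ex_Der] Der_B[OF Et_Der] Der_B[OF Ex_Der]

lemma pt_sym:
  assumes "i \<in> J" "j \<in> J" shows "pt i j = pt j i"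
proof -
  have "pt i j - pt j i = 0"
    by (rule pair_eq_0) (use assms in \<open>auto simp: fst_pt fun_ops E_simps algebra_simps\<close>)
  then show ?thesis by simp
qed

lemma pt_disjoint:
  assumes "i \<in> J" "j \<in> J" "k \<in> J" "l \<in> J" "{i, j} \<inter> {k, l} = {}"
  shows "pbr (pt i j) (pt k l) = 0"
proof -
  from assms have ne: "i \<noteq> k" "i \<noteq> l" "j \<noteq> k" "j \<noteq> l" by auto
  show ?thesis
  proof (rule pair_eq_0)
    show "fst (pbr (pt i j) (pt k l)) = 0"
      using assms(1-4) ne ne[symmetric]
      by (cases "o1 \<in> {i, j}"; cases "o1 \<in> {k, l}")
        (auto simp: fst_pt eps_def E_linear E_simps B_bilinear central central' B_self)
  qed (use assms(1-4) ne ne[symmetric] in \<open>auto simp: E_linear E_simps\<close>)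
qed

lemma pt_triangle:
  assumes "i \<in> J" "j \<in> J" "k \<in> J" "k \<notin> {i, j}"
  shows "pbr (pt i j) (pt i k + pt j k) = 0"
proof (rule pair_eq_0)
  from assms have ne: "i \<noteq> k" "j \<noteq> k" "k \<noteq> i" "k \<noteq> j" by auto
  show "fst (pbr (pt i j) (pt i k + pt j k)) = 0"
    using assms(1-3) ne B_anti[of "a j" "a i"]
    by (cases "i = j"; cases "i = o1"; cases "j = o1"; cases "k = o1")
      (auto simp: fst_pt eps_def fun_ops E_linear E_simps B_bilinear central central' B_self)
  show "snd (pbr (pt i j) (pt i k + pt j k)) (a m) = 0" if "m \<in> J" for m
  proof (cases "i = j")
    case True
    then show ?thesis using assms(1-3) ne that
      by (auto simp: fun_ops E_linear E_simps B_self B_bilinear)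
  next
    case False
    consider "m = i" | "m = j" | "m = k" | "m \<notin> {i, j, k}" by auto
    then show ?thesis
    proof cases
      case 1
      \<comment> \<open>Here the value is the Jacobi identity for \<open>a i\<close>,
        \<open>a j\<close>, \<open>a k\<close>.\<close>
      then show ?thesis
        using assms(1-3) ne False B_leibniz[of "a i" "a j" "a k"] B_anti[of "a j" "B (a i) (a k)"]
        by (simp add: fun_ops E_linear E_simps B_bilinear)
    next
      case 2
      then show ?thesis
        using assms(1-3) ne False B_leibniz[of "a j" "a i" "a k"] B_anti[of "a i" "B (a j) (a k)"]
        by (simp add: fun_ops E_linear E_simps B_bilinear)
    next
      case 3
      then show ?thesis
        using assms(1-3) ne False B_anti[of "a j" "a i"]
        by (simp add: fun_ops E_linear E_simps B_bilinear)
    next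
      case 4
      then show ?thesis
        using assms(1-3) ne False that by (simp add: fun_ops E_linear E_simps B_bilinear)
    qed
  qed
qed (use assms in \<open>simp_all add: fun_ops E_linear E_simps\<close>)

lemma px_px:
  assumes "c \<in> cols g" "d \<in> cols g" "i \<in> J" "j \<in> J" "i \<noteq> j"
  shows "pbr (px c i) (px d j) = psc (omega c d) (pt i j)"
proof -
  have o: "omega d c = - omega c d" by (rule omega_anti)
  have "pbr (px c i) (px d j) - psc (omega c d) (pt i j) = 0"
  proof (rule pair_eq_0)
    show "fst (pbr (px c i) (px d j) - psc (omega c d) (pt i j)) = 0"
      using assms by (cases "i = o1"; cases "j = o1")
        (simp_all add: fst_pt fst_px eps_def E_linear E_simps o B_bilinear)
    show "snd (pbr (px c i) (px d j) - psc (omega c d) (pt i j)) (a m) = 0" if "m \<in> J" for m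
      using assms that by (auto simp: fun_ops E_linear E_simps o B_bilinear)
  qed (use assms in \<open>auto simp: fun_ops E_linear E_simps\<close>)
  then show ?thesis by simp
qed

lemma px_pt:
  assumes "c \<in> cols g" "i \<in> J" "j \<in> J" "k \<in> J" "k \<notin> {i, j}"
  shows "pbr (px c k) (pt i j) = 0"
proof (rule pair_eq_0)
  from assms have ne: "i \<noteq> k" "j \<noteq> k" "k \<noteq> i" "k \<noteq> j" by auto
  show "fst (pbr (px c k) (pt i j)) = 0"
    using assms(1-4) ne by (cases "i = o1"; cases "j = o1"; cases "k = o1")
      (simp_all add: fst_pt fst_px eps_def E_linear E_simps B_bilinear central')
  show "snd (pbr (px c k) (pt i j)) (a m) = 0" if "m \<in> J" for m
    using assms(1-4) ne that by (auto simp: E_linear E_simps)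
qed (use assms in \<open>auto simp: E_linear E_simps\<close>)

lemma px_add_pt:
  assumes "c \<in> cols g" "i \<in> J" "j \<in> J"
  shows "pbr (px c i + px c j) (pt i j) = 0"
proof (rule pair_eq_0)
  show "fst (pbr (px c i + px c j) (pt i j)) = 0"
    using assms B_anti[of "a i" "x c"] B_anti[of "a j" "x c"]
    by (cases "i = j"; cases "i = o1"; cases "j = o1")
      (auto simp: fst_pt fst_px fun_ops eps_def E_linear E_simps B_bilinear central')
  show "snd (pbr (px c i + px c j) (pt i j)) (a m) = 0" if "m \<in> J" for m
  proof -
    have jac: "B (B u v) w + B (B v w) u = B (B u w) v" for u v w
      using B_leibniz[of u v w] B_anti[of u "B v w"] B_anti[of v "B u w"]
          by (simp add: algebra_simps)
    show ?thesis
      using assms that jac[of "a i" "a j" "x c"] jac[of "a j" "a i" "x c"]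
        B_anti[of "a j" "B (a i) (x c)"] B_anti[of "a i" "B (a j) (x c)"]
      by (cases "i = j"; cases "m = i"; cases "m = j")
        (auto simp: fun_ops E_linear E_simps B_bilinear B_self algebra_simps)
  qed
  show "snd (pbr (px c i + px c j) (pt i j)) (x d) = 0" if "d \<in> cols g" for d
    using assms that B_anti[of "a j" "a i"]
    by (auto simp: fun_ops E_linear E_simps B_bilinear B_self)
qed (use assms in \<open>auto simp: fun_ops E_linear E_simps\<close>)

lemma pairing_simps: "omega (True, b) (False, b) = 1" "omega (False, b) (True, b) = - 1"
  by (simp_all add: omega_def)

text \<open>The summand \<open>inn (a i)\<close> is t_is. The relation for the strand
  \<open>i\<close> is deduced from \<open>sum_a\<close>, the one for the strand \<open>s\<close>,
  which enters the first component and the action on \<open>a i\<close>.\<close>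

lemma px_sum:
  assumes i: "i \<in> J"
  shows "(\<Sum>b\<in>{1..g}. pbr (px (True, b) i) (px (False, b) i)) + (inn (a i) + (\<Sum>j\<in>J - {i}. pt i j)) =
    psc (of_nat g - 1) (pt i i)" (is "?S + (inn (a i) + ?T) = ?R")
proof -
  have cols [simp]: "b \<in> {1..g} \<Longrightarrow> (p, b) \<in> cols g" for p b by (simp add: cols_def)
  have fin: "finite (J - {i})" using finite_J by simp
  have sum_J: "sum a J = a i + (\<Sum>j\<in>J - {i}. a j)"
    using finite_J i by (rule sum.remove)
  have "?S + (inn (a i) + ?T) - ?R = 0"
  proof (rule pair_eq_0)
    show "?S + (inn (a i) + ?T) - ?R \<in> pS"
      using i by (intro pair.diff_closed pair.add_closed pair.sum_closed pair.scale_closed) auto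
    \<comment> \<open>Each pair of x and y acts on the other by +1 and -1 times \<open>a i\<close>,
      whence \<open>a i + a i\<close>; the quadratic term is the correction by \<open>B\<close> in
      \<open>pbr\<close>.\<close>
    have S: "fst ?S = (\<Sum>b\<in>{1..g}. sc (eps i) (a i + a i) - sc (eps i * eps i) (B (x (True,
        b)) (x (False, b))))"
      unfolding fst_sum using i
      by (intro sum.cong refl)
        (simp add: fst_px E_linear E_simps pairing_simps B_bilinear algebra_simps)
    have sum_x: "(\<Sum>b\<in>{1..g}. B (x (True, b)) (x (False, b))) =
        sc (of_nat g - 1) c0 - (a i + (\<Sum>j\<in>J - {i}. a j))"
      using sum_a by (simp add: sum_J eq_diff_eq)
    have S': "fst ?S = sc (of_nat g * eps i) (a i + a i)
        - sc (eps i * eps i) (sc (of_nat g - 1) c0 - (a i + (\<Sum>j\<in>J - {i}. a j)))"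
    proof -
      have "(\<Sum>b\<in>{1..g}. sc (eps i) (a i + a i)) = sc (of_nat g * eps i) (a i + a i)"
        by (subst sum_constant_scale) simp
      then show ?thesis
        by (simp only: S sum_subtractf sum_x flip: scale_sum_right)
    qed
    have fst_eq: "fst (?S + (inn (a i) + ?T) - ?R) =
        fst ?S + (a i + fst ?T) - sc (of_nat g - 1) (fst (pt i i))"
      by (simp only: fst_add fst_diff fst_inn fst_psc)
    show "fst (?S + (inn (a i) + ?T) - ?R) = 0"
    proof (cases "i = o1")
      case True
      then have "fst ?T = (\<Sum>j\<in>J - {i}. - a j)"
        unfolding fst_sum by (intro sum.cong refl) (auto simp: fst_pt eps_def)
      then show ?thesis
        unfolding fst_eq S' using True by (simp add: sum_negf fst_pt eps_def algebra_simps)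
    next
      case False
      then have "fst ?T = (\<Sum>j\<in>J - {i}. if j = o1 then - a i else 0)"
        unfolding fst_sum by (intro sum.cong refl) (auto simp: fst_pt eps_def)
      then have "fst ?T = - a i" using fin o1 False by simp
      then show ?thesis
        unfolding fst_eq S' using False by (simp add: fst_pt eps_def)
    qed
    have snd_S: "snd ?S w = (\<Sum>b\<in>{1..g}. Ex (True, b) i (Ex (False, b) i w) - Ex (False,
        b) i (Ex (True, b) i w))"
      for w by (simp add: snd_sum sum_fun_apply)
    have snd_T: "snd ?T w = (\<Sum>j\<in>J - {i}. Et i j w)" for w
      by (simp add: snd_sum sum_fun_apply)
    have snd_eq: "snd (?S + (inn (a i) + ?T) - ?R) w =
        snd ?S w + (B (a i) w + (\<Sum>j\<in>J - {i}. Et i j w)) - sc (of_nat g - 1) (Et i i w)" for w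
      by (simp only: snd_add snd_diff snd_inn snd_psc fun_ops snd_T snd_pt)
    show "snd (?S + (inn (a i) + ?T) - ?R) (x d) = 0" if d: "d \<in> cols g" for d
    proof -
      obtain p e where [simp]: "d = (p, e)" and e: "e \<in> {1..g}" using d by (auto simp: cols_def)
      have "snd ?S (x d) = (\<Sum>b\<in>{1..g}. if b = e then - B (a i) (x d) else 0)"
        unfolding snd_S using i d
        by (intro sum.cong refl) (cases p; auto simp: E_linear E_simps omega_def)
      then have "snd ?S (x d) = - B (a i) (x d)" using e by simp
      moreover have "(\<Sum>j\<in>J - {i}. Et i j (x d)) = 0" using i d by (simp add: E_simps)
      ultimately show ?thesis unfolding snd_eq using i d by (simp add: E_simps)
    qed
    show "snd (?S + (inn (a i) + ?T) - ?R) c0 = 0"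
    proof -
      have "snd ?S c0 = 0" unfolding snd_S using i by (simp add: E_linear E_simps)
      then show ?thesis unfolding snd_eq using i by (simp add: E_simps central')
    qed
    show "snd (?S + (inn (a i) + ?T) - ?R) (a m) = 0" if m: "m \<in> J" for m
    proof (cases "m = i")
      case False
      have "snd ?S (a m) = 0" unfolding snd_S using i m False by (simp add: E_linear E_simps)
      moreover have "(\<Sum>j\<in>J - {i}. Et i j (a m)) = (\<Sum>j\<in>J - {i}. if m = j then B (a m) (a i) else 0)"
        using i m False by (intro sum.cong refl) (auto simp: E_simps)
      moreover have "\<dots> = B (a m) (a i)" using fin m False by simp
      ultimately show ?thesis
        unfolding snd_eq using i m False B_anti[of "a m" "a i"] by (simp add: E_simps)
    next
      case True
      \<comment> \<open>By Jacobi the commutator of the two derivations sends \<open>a i\<close> to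
        its bracket with [x, y], so the sum over \<open>b\<close> can be replaced by means of
        \<open>sum_a\<close>; \<open>c0\<close> drops out as central.\<close>
      have jac: "B (B u v) w - B (B u w) v = B u (B v w)" for u v w
        using B_leibniz[of u v w] B_anti[of v "B u w"] by (simp add: algebra_simps)
      have "snd ?S (a m) = (\<Sum>b\<in>{1..g}. B (a i) (B (x (True, b)) (x (False, b))))"
        unfolding snd_S True using i
        by (intro sum.cong refl) (simp add: E_linear E_simps pairing_simps B_self B_bilinear
            flip: jac)
      also have "\<dots> = B (a i) (\<Sum>b\<in>{1..g}. B (x (True, b)) (x (False, b)))"
        by (simp add: B_sum_right)
      also have "\<dots> = B (a i) (sc (of_nat g - 1) c0 - (a i + (\<Sum>j\<in>J - {i}. a j)))"
        by (simp only: sum_x)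
      finally have "snd ?S (a m) = - (\<Sum>j\<in>J - {i}. B (a i) (a j))"
        by (simp add: B_bilinear central' B_self)
      moreover have "(\<Sum>j\<in>J - {i}. Et i j (a m)) = (\<Sum>j\<in>J - {i}. B (a i) (a j))"
        unfolding True using i by (intro sum.cong refl) (auto simp: E_simps)
      ultimately show ?thesis unfolding snd_eq unfolding True using i by (simp add: E_simps B_self)
    qed
  qed
  then show ?thesis by simp
qed

text \<open>A relation involving the strand \<open>s\<close> becomes, by
  \<open>pbr_inn_right\<close> and \<open>pbr_inn_left\<close>, a statement on the values of
  \<open>Et\<close> and \<open>Ex\<close>; the others are the lemmas above.\<close>

lemma tf_family_pairs: "tf_family psc pS pbr g (insert s J) ft fx"
proof
  have ns [simp]: "i \<in> J \<Longrightarrow> i \<noteq> s" "i \<in> J \<Longrightarrow> s \<noteq> i" for i using s by auto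
  note L = pbr_inn_right pbr_inn_left
  note inn = inn_linear(1-4)[symmetric]
  have inn_0: "w = 0 \<Longrightarrow> inn w = 0" for w by (simp add: inn_linear)
  show "finite (insert s J)" using finite_J by simp
  show "ft i j \<in> pS" if "i \<in> insert s J" "j \<in> insert s J" for i j
    using that by (auto simp: ft_def)
  show "fx c i \<in> pS" if "c \<in> cols g" "i \<in> insert s J" for c i
    using that by (auto simp: fx_def)
  show "ft i j = ft j i" if "i \<in> insert s J" "j \<in> insert s J" for i j
    using that pt_sym by (auto simp: ft_def)
  show "pbr (ft i j) (ft k l) = 0"
    if "i \<in> insert s J" "j \<in> insert s J" "k \<in> insert s J" "l \<in> insert s J" "{i, j} \<inter> {k, l} = {}"
    for i j k l
    using that pt_disjoint[of i j k l] by (auto simp: ft_def L E_simps inn_linear)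
  show "pbr (ft i j) (ft i k + ft j k) = 0"
    if ijk: "i \<in> insert s J" "j \<in> insert s J" "k \<in> insert s J" "k \<notin> {i, j}" for i j k
  proof -
    consider "i \<in> J" "j \<in> J" "k \<in> J" | "i \<in> J" "j \<in> J" "k = s" | "i = s" "j = s" "k \<in> J"
      | "i = s" "j \<in> J" "k \<in> J" | "i \<in> J" "j = s" "k \<in> J"
      using ijk by auto
    then show ?thesis
    proof cases
      case 1 then show ?thesis using ijk pt_triangle[of i j k] by (simp add: ft_def)
    next
      case 2
      then have "Et i j (a i + a j) = 0"
        using B_anti[of "a j" "a i"] by (cases "i = j") (simp_all add: E_linear E_simps B_self)
      then show ?thesis using 2 by (simp add: ft_def inn L inn_0)
    next
      case 3 then show ?thesis by (simp add: ft_def inn L inn_0 central)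
    next
      case 4
      then show ?thesis using ijk
        by (simp add: ft_def pair.B_add_right L E_simps) (simp add: inn inn_0)
    next
      case 5
      then show ?thesis using ijk
        by (simp add: ft_def pair.B_add_right L E_simps) (simp add: inn inn_0)
    qed
  qed
  show "pbr (fx c i) (fx d j) = psc (omega c d) (ft i j)"
    if cd: "c \<in> cols g" "d \<in> cols g" "i \<in> insert s J" "j \<in> insert s J" "i \<noteq> j" for c d i j
  proof -
    have "omega d c = - (omega c d :: 'k)" by (rule omega_anti)
    then show ?thesis
      using cd px_px[of c d i j] by (auto simp: fx_def ft_def L E_simps inn_linear)
  qed
  show "pbr (fx c k) (ft i j) = 0"
    if "c \<in> cols g" "i \<in> insert s J" "j \<in> insert s J" "k \<in> insert s J" "k \<notin> {i, j}" for c i j k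
    using that px_pt[of c i j k] by (auto simp: fx_def ft_def L E_simps inn_linear)
  show "pbr (fx c i + fx c j) (ft i j) = 0"
    if c: "c \<in> cols g" and ij: "i \<in> insert s J" "j \<in> insert s J" for c i j
  proof -
    consider "i \<in> J" "j \<in> J" | "i = s" "j = s" | "i = s" "j \<in> J" | "i \<in> J" "j = s"
      using ij by auto
    then show ?thesis
    proof cases
      case 1 then show ?thesis using c px_add_pt[of c i j] by (simp add: fx_def ft_def)
    next
      case 2 then show ?thesis
        by (simp add: fx_def ft_def pair.B_add_left L central' inn_linear fun_ops)
    next
      case 3 then show ?thesis using c B_anti[of "x c" "a j"]
        by (simp add: fx_def ft_def L E_simps inn_linear fun_ops)
    next
      case 4 then show ?thesis using c B_anti[of "x c" "a i"]
        by (simp add: fx_def ft_def L E_simps inn_linear fun_ops)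
    qed
  qed
  show "(\<Sum>b\<in>{1..g}. pbr (fx (True, b) i) (fx (False, b) i)) + (\<Sum>j\<in>insert s J - {i}. ft i j) =
      psc (of_nat g - 1) (ft i i)" if "i \<in> insert s J" for i
    using that
  proof
    assume i: "i = s"
    have "insert s J - {s} = J" using s by auto
    then have "(\<Sum>j\<in>insert s J - {i}. ft i j) = inn (sum a J)"
      using i by (simp add: ft_def inn_sum)
    moreover have "(\<Sum>b\<in>{1..g}. pbr (fx (True, b) i) (fx (False, b) i)) =
        inn (\<Sum>b\<in>{1..g}. B (x (True, b)) (x (False, b)))"
      using i by (simp add: fx_def L inn_sum)
    ultimately show ?thesis
      by (simp only: inn sum_a) (simp add: i ft_def inn_linear)
  next
    assume i: "i \<in> J"
    have "insert s J - {i} = insert s (J - {i})" using i by auto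
    then have "(\<Sum>j\<in>insert s J - {i}. ft i j) = inn (a i) + (\<Sum>j\<in>J - {i}. ft i j)"
      using finite_J s i by (simp add: ft_def)
    moreover have "(\<Sum>j\<in>J - {i}. ft i j) = (\<Sum>j\<in>J - {i}. pt i j)"
      using i by (intro sum.cong refl) (auto simp: ft_def)
    ultimately show ?thesis using px_sum[OF i] i by (simp add: fx_def ft_def)
  qed
qed

end

section \<open>Derivations of a presented Lie algebra\<close>

context presentation
begin

sublocale ext: derivation_extension msmult qbr Ders
proof unfold_locales
  fix E F :: "('x tree \<Rightarrow> 'k) \<Rightarrow> ('x tree \<Rightarrow> 'k)" and u v w c
  show "0 \<in> Ders" by (simp add: Ders_def fun_ops)
  show "qbr v \<in> Ders"
    unfolding Ders_def mem_Collect_eq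
    by (intro conjI allI Q.B_leibniz) (simp_all add: Q.B_add_right Q.B_scale_right qbr_P)
  assume E: "E \<in> Ders"
  then show "E (u + v) = E u + E v" "E (msmult c u) = msmult c (E u)"
    "E (qbr u v) = qbr (E u) v + qbr u (E v)"
    by (auto simp: Ders_def)
  show "(\<lambda>w. msmult c (E w)) \<in> Ders"
    using E by (simp add: Ders_def Q.B_bilinear Q.scale_right_distrib mult.commute)
  assume F: "F \<in> Ders"
  show "E + F \<in> Ders"
    using E F by (simp add: Ders_def Q.B_bilinear fun_ops Q.scale_right_distrib add_ac)
  show "(\<lambda>w. E (F w) - F (E w)) \<in> Ders"
    using E F by (simp add: Ders_def Q.B_bilinear Q.scale_right_diff_distrib algebra_simps)
qed

definition derivation :: "('x \<Rightarrow> 'x tree \<Rightarrow> 'k) \<Rightarrow> ('x tree \<Rightarrow> 'k) \<Rightarrow> ('x tree \<Rightarrow> 'k)" where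
  "derivation \<delta> = (SOME D. D \<in> Ders \<and> (\<forall>x\<in>G. D (gen x) = \<delta> x))"

lemma derivation:
  assumes "\<And>r. r \<in> R \<Longrightarrow> ev dsc dbr (\<lambda>x. (P (gen x), \<delta> x)) r = 0"
  shows "derivation \<delta> \<in> Ders" "x \<in> G \<Longrightarrow> derivation \<delta> (gen x) = \<delta> x"
proof -
  have "\<exists>D. D \<in> Ders \<and> (\<forall>x\<in>G. D (gen x) = \<delta> x)"
    using exists_derivation[OF assms] by blast
  from someI_ex[OF this]
  show "derivation \<delta> \<in> Ders" "x \<in> G \<Longrightarrow> derivation \<delta> (gen x) = \<delta> x"
    unfolding derivation_def by blast+
qed

text \<open>The map ad v is itself a derivation, so it is zero once it vanishes on
  generators.\<close>

lemma qbr_central: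
  assumes "\<And>x. x \<in> G \<Longrightarrow> qbr v (P (gen x)) = 0"
  shows "qbr v w = 0"
proof -
  have "qbr v = 0"
    by (rule Ders_ext[OF ext.Der_ad]) (use assms in \<open>simp only: qbr_P\<close>)
  then show ?thesis by (simp add: fun_ops)
qed

lemma hom_lie_ideal:
  fixes R' :: "('y tree \<Rightarrow> 'k) set"
  assumes "\<And>r. r \<in> R' \<Longrightarrow> in_mag G' r" "\<And>x. x \<in> G' \<Longrightarrow> in_mag G (\<phi> x)"
    and "\<And>r. r \<in> R' \<Longrightarrow> ev msmult qbr (\<lambda>x. P (\<phi> x)) r = 0"
    and u: "u \<in> lie_ideal G' R'"
  shows "hom \<phi> u \<in> I"
proof -
  interpret source: presentation G' R' by unfold_locales fact
  have u': "in_mag G' u" by (rule source.ideal_in_mag[OF u])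
  have "fin u \<and> ev msmult qbr (\<lambda>x. P (\<phi> x)) u = 0"
    by (rule Q.ev_lie_ideal[OF _ _ u]) (simp_all add: assms(3) in_mag_fin[OF assms(1)])
  then have "P (hom \<phi> u) = 0" using P_hom[OF u' assms(2)] by simp
  moreover have "in_mag G (hom \<phi> u)" using u' assms(2) by (rule in_mag_hom)
  ultimately show ?thesis using P_eq_0_iff by simp
qed

end

lemma tf_family_cong:
  assumes "tf_family sc S B g I t z"
    and t: "\<And>i j. i \<in> I \<Longrightarrow> j \<in> I \<Longrightarrow> t' i j = t i j"
    and z: "\<And>c i. c \<in> cols g \<Longrightarrow> i \<in> I \<Longrightarrow> z' c i = z c i"
  shows "tf_family sc S B g I t' z'"
proof -
  interpret tf_family sc S B g I t z by fact
  show ?thesis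
  proof
    fix i assume i: "i \<in> I"
    have "(\<Sum>a\<in>{1..g}. B (z' (True, a) i) (z' (False, a) i)) = (\<Sum>a\<in>{1..g}. B (z (True,
        a) i) (z (False, a) i))"
      using i by (intro sum.cong refl) (auto simp: z cols_def)
    moreover have "(\<Sum>j\<in>I - {i}. t' i j) = (\<Sum>j\<in>I - {i}. t i j)"
      using i by (intro sum.cong refl) (auto simp: t)
    ultimately show "(\<Sum>a\<in>{1..g}. B (z' (True, a) i) (z' (False, a) i)) + (\<Sum>j\<in>I - {i}. t' i j) =
        sc (of_nat g - 1) (t' i i)"
      using i z_sum[OF i] by (simp add: t)
  qed (simp_all add: t z finite_index t_sym t_disjoint t_triangle z_z z_t z_add_t)
qed

interpretation br: bilinear_on "msmult :: 'k::field \<Rightarrow> ('x tree \<Rightarrow> 'k) \<Rightarrow> _" UNIV br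
  by (rule bilinear_on_br)

lemma hom_simps [simp]:
  fixes \<phi> :: "'x \<Rightarrow> 'y tree \<Rightarrow> 'k::field"
  shows "hom \<phi> 0 = 0" "hom \<phi> (gen x) = \<phi> x"
    "fin u \<Longrightarrow> fin v \<Longrightarrow> hom \<phi> (u + v) = hom \<phi> u + hom \<phi> v"
    "fin u \<Longrightarrow> fin v \<Longrightarrow> hom \<phi> (u - v) = hom \<phi> u - hom \<phi> v"
    "fin u \<Longrightarrow> hom \<phi> (msmult c u) = msmult c (hom \<phi> u)"
    "fin u \<Longrightarrow> fin v \<Longrightarrow> hom \<phi> (br u v) = br (hom \<phi> u) (hom \<phi> v)"
  by (simp_all add: hom_eq_ev)

lemma idx_n_star_0_eq: "idx_n_star_0 n = insert Star (idx_n_0 n)"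
  by (auto simp: idx_n_star_0_def idx_n_0_def)

lemma Star_notin [simp]: "Star \<notin> idx_n_0 n"
  and Zero_in [simp]: "Zero \<in> idx_n_0 n"
  and finite_idx [simp]: "finite (idx_n_0 n)"
  by (auto simp: idx_n_0_def)

section \<open>The exact sequence\<close>

locale exact_sequence =
  fixes g n :: nat and K :: "'k::field_char_0 itself"
begin

abbreviation "J \<equiv> idx_n_0 n"

sublocale t: presentation "tf_gens g (insert Star J)" "tf_rels g (insert Star J) :: (_ \<Rightarrow> 'k) set"
  by unfold_locales (rule tf_rels_in_mag)

sublocale s: presentation "tf_gens g J" "tf_rels g J :: (_ \<Rightarrow> 'k) set"
  by unfold_locales (rule tf_rels_in_mag)

sublocale u: presentation "uf_gens g n" "uf_rels g n :: (_ \<Rightarrow> 'k) set"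
  by unfold_locales (rule uf_rels_in_mag)

sublocale tfam: tf_family_char_0 msmult UNIV t.qbr g "insert Star J"
  "\<lambda>i j. t.P (gen (T i j))" "\<lambda>c i. t.P (gen (Z c i))"
  unfolding tf_family_char_0_def
  by (rule t.Q.tf_family_of_ev) (auto intro: t.ev_relator)

sublocale sfam: tf_family_char_0 msmult UNIV s.qbr g J
  "\<lambda>i j. s.P (gen (T i j))" "\<lambda>c i. s.P (gen (Z c i))"
  unfolding tf_family_char_0_def
  by (rule s.Q.tf_family_of_ev) (auto intro: s.ev_relator)

lemma uf_gens_cases:
  assumes "h \<in> uf_gens g n"
  obtains j where "j \<in> J" "h = T j Star" "j \<noteq> Zero" | c where "c \<in> cols g" "h = Z c Star" | "h
      = T Star Star"
proof -
  have "(\<exists>j. j \<in> J \<and> h = T j Star \<and> j \<noteq> Zero) \<or> (\<exists>c. c \<in> cols g \<and> h = Z c Star) \<or> h = T Star Star"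
    using assms unfolding uf_gens_def H_gens_def
  proof (elim UnE CollectE exE conjE)
    fix a assume "h = X a Star" "1 \<le> a" "a \<le> g"
    then show ?thesis by (intro disjI2 disjI1 exI[of _ "(True, a)"]) (auto simp: Z_def cols_def)
  next
    fix a assume "h = Y a Star" "1 \<le> a" "a \<le> g"
    then show ?thesis by (intro disjI2 disjI1 exI[of _ "(False, a)"]) (auto simp: Z_def cols_def)
  qed (auto simp: idx_n_0_def)
  then show ?thesis using that by blast
qed

lemma tf_gens_cases:
  assumes "h \<in> tf_gens g (I :: idx set)"
  obtains i j where "i \<in> I" "j \<in> I" "h = T i j" | c i where "c \<in> cols g" "i \<in> I" "h = Z c i"
proof -
  have "(\<exists>i j. i \<in> I \<and> j \<in> I \<and> h = T i j) \<or> (\<exists>c i. c \<in> cols g \<and> i \<in> I \<and> h = Z c i)"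
    using assms unfolding tf_gens_def
  proof (elim UnE CollectE exE conjE)
    fix a i assume "h = X a i" "1 \<le> a" "a \<le> g" "i \<in> I"
    then show ?thesis by (intro disjI2 exI[of _ "(True, a)"] exI[of _ i]) (auto simp: Z_def
        cols_def)
  next
    fix a i assume "h = Y a i" "1 \<le> a" "a \<le> g" "i \<in> I"
    then show ?thesis by (intro disjI2 exI[of _ "(False,
        a)"] exI[of _ i]) (auto simp: Z_def cols_def)
  qed auto
  then show ?thesis using that by blast
qed

lemma gens_simps:
  "T i j \<in> tf_gens g I \<longleftrightarrow> i \<in> I \<and> j \<in> I" "c \<in> cols g \<Longrightarrow> Z c i \<in> tf_gens g I \<longleftrightarrow> i \<in> I"
  "j \<in> J \<Longrightarrow> j \<noteq> Zero \<Longrightarrow> T j Star \<in> uf_gens g n" "c \<in> cols g \<Longrightarrow> Z c Star \<in> uf_gens g n"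
  "T Star Star \<in> uf_gens g n"
  by (auto simp: tf_gens_def Z_def cols_def uf_gens_def H_gens_def idx_n_0_def)

lemma uf_gens_subset: "uf_gens g n \<subseteq> tf_gens g (insert Star J)"
  by (auto elim!: uf_gens_cases simp: gens_simps)

section \<open>The three maps respect the ideals\<close>

lemma hom_iota: "in_mag G u \<Longrightarrow> hom iota_map u = (u :: _ \<Rightarrow> 'k)"
  by (induction rule: in_mag_induct) (simp_all add: in_mag_fin iota_map_def)

lemma iota_ideal: "u \<in> u.I \<Longrightarrow> hom iota_map u \<in> t.I"
proof (rule t.hom_lie_ideal[OF uf_rels_in_mag])
  fix r :: "_ \<Rightarrow> 'k" assume "r \<in> uf_rels g n"
  then obtain h where h: "h \<in> H_gens g n" "r = br (gen (T Star Star)) (gen h)"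
    by (auto simp: uf_rels_def)
  then have "h \<in> uf_gens g n" by (simp add: uf_gens_def)
  then have "t.qbr (t.P (gen (T Star Star))) (t.P (gen h)) = 0"
    by (cases rule: uf_gens_cases) (auto simp: tfam.diag_t tfam.diag_z)
  then show "ev msmult t.qbr (\<lambda>x. t.P (iota_map x)) r = 0" using h by (simp add: iota_map_def)
qed (use uf_gens_subset in \<open>auto simp: iota_map_def intro!: in_mag_gen\<close>)

lemma eps_map_simps: "eps_map (T i j) = (if i = Star \<or> j = Star then 0 else gen (T i j) :: _ \<Rightarrow> 'k)"
  "eps_map (Z c i) = (if i = Star then 0 else gen (Z c i) :: _ \<Rightarrow> 'k)"
  by (auto simp: eps_map_def has_star_def Z_def)

lemma eps_in_mag: "x \<in> tf_gens g (insert Star J) \<Longrightarrow> in_mag (tf_gens g J) (eps_map x :: _ \<Rightarrow> 'k)"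
  by (erule tf_gens_cases) (auto simp: eps_map_simps gens_simps intro!: in_mag_gen)

lemma eps_ideal: "v \<in> t.I \<Longrightarrow> hom eps_map v \<in> s.I"
proof (rule s.hom_lie_ideal[OF tf_rels_in_mag eps_in_mag])
  have "tf_family msmult UNIV s.qbr g (insert Star J) (\<lambda>i j. s.P (eps_map (T i j))) (\<lambda>c i. s.P
      (eps_map (Z c i)))"
    using sfam.tf_family_extend_by_zero[of Star] by (rule tf_family_cong) (auto simp: eps_map_simps)
  then show "ev msmult s.qbr (\<lambda>x. s.P (eps_map x)) r = 0" if "r \<in> tf_rels g (insert Star J)" for r
    using s.Q.ev_tf_rels[OF _ _ that, of "\<lambda>x. s.P (eps_map x)"] by simp
qed

lemma split_map_Z: "i \<in> J \<Longrightarrow> split_map (Z c i) = (gen (Z c i) + (if i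
    = Zero then gen (Z c Star) else 0) :: _ \<Rightarrow> 'k)"
  by (cases i) (auto simp: Z_def add.commute)

text \<open>Brings \<open>split_map\<close> to the shape required by
  \<open>tf_family_double\<close>. In the quotient 2 t_{*0} equals t_{*0} + t_{0*}.\<close>

lemma P_split_T:
  assumes "i \<in> J" "j \<in> J"
  shows "t.P (split_map (T i j)) = t.P (gen (T i j)) + (if j
      = Zero then t.P (gen (T i Star)) else 0)
     + (if i = Zero then t.P (gen (T Star j)) else 0) + (if i = Zero \<and> j
         = Zero then t.P (gen (T Star Star)) else 0)"
proof -
  have sym: "t.P (gen (T k l)) = t.P (gen (T l k))" if "k \<in> insert Star J"
      "l \<in> insert Star J" for k l
    using tfam.t_sym that by simp
  have two: "2 * x = msmult 2 x" for x :: "gen_sym tree \<Rightarrow> 'k"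
    by (simp add: fun_eq_iff msmult_def)
  show ?thesis
    using assms sym[of Star i] sym[of Star j] sym[of i j]
    by (cases i; cases j) (auto simp: t.P_add t.P_smult two add_ac)
qed

lemma split_in_mag: "x \<in> tf_gens g J \<Longrightarrow> in_mag (tf_gens g (insert Star J)) (split_map x :: _ \<Rightarrow> 'k)"
proof (erule tf_gens_cases)
  fix i j assume "i \<in> J" "j \<in> J" "x = T i j"
  then show ?thesis
    by (cases i; cases j) (auto simp: gens_simps intro!: in_mag_add in_mag_smult in_mag_gen)
next
  fix c i assume "c \<in> cols g" "i \<in> J" "x = Z c i"
  then show ?thesis by (auto simp: split_map_Z gens_simps intro!: in_mag_add in_mag_gen)
qed

lemma split_ideal: "w \<in> s.I \<Longrightarrow> hom split_map w \<in> t.I"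
proof (rule t.hom_lie_ideal[OF tf_rels_in_mag split_in_mag])
  have "tf_family msmult UNIV t.qbr g J (\<lambda>i j. t.P (split_map (T i j))) (\<lambda>c i. t.P (split_map (Z
      c i)))"
    using tfam.tf_family_double[of Star J Zero]
    by (rule tf_family_cong) (auto simp: P_split_T split_map_Z t.P_add)
  then show "ev msmult t.qbr (\<lambda>x. t.P (split_map x)) r = 0" if "r \<in> tf_rels g J" for r
    using t.Q.ev_tf_rels[OF _ _ that, of "\<lambda>x. t.P (split_map x)"] by simp
qed

lemma hom_eps_in_mag: "in_mag (tf_gens g (insert Star J)) v
    \<Longrightarrow> in_mag (tf_gens g J) (hom eps_map v :: _ \<Rightarrow> 'k)"
  by (rule in_mag_hom[OF _ eps_in_mag])

lemma hom_split_in_mag: "in_mag (tf_gens g J) w \<Longrightarrow> in_mag (tf_gens g (insert Star J)) (hom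
    split_map w :: _ \<Rightarrow> 'k)"
  by (rule in_mag_hom[OF _ split_in_mag])

lemmas fin_hom = hom_eps_in_mag[THEN in_mag_fin] hom_split_in_mag[THEN in_mag_fin]

lemma eps_iota:
  assumes "in_mag (uf_gens g n) u" shows "hom eps_map (u :: _ \<Rightarrow> 'k) = 0"
  using assms
proof (induction rule: in_mag_induct)
  case (gen h)
  then show ?case by (cases rule: uf_gens_cases) (auto simp: eps_map_simps)
qed (simp_all add: in_mag_fin)

text \<open>The equation holds only modulo the relations: \<open>split_map\<close> expresses
  \<open>T Zero (Pt i)\<close> through \<open>T (Pt i) Zero\<close>, so the symmetry of t is
  needed.\<close>

lemma eps_split:
  assumes "in_mag (tf_gens g J) w" shows "s.P (hom eps_map (hom split_map w)) = s.P (w :: _ \<Rightarrow> 'k)"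
  using assms
proof (induction rule: in_mag_induct)
  case (gen h)
  then show ?case
  proof (cases rule: tf_gens_cases)
    case (1 i j)
    then show ?thesis
      using sfam.t_sym[of i j] by (cases i; cases j) (auto simp: eps_map_simps)
  next
    case (2 c i)
    then show ?thesis by (auto simp: split_map_Z eps_map_simps)
  qed
next
  case (br u v)
  then show ?case by (simp add: in_mag_fin fin_hom s.P_br hom_eps_in_mag hom_split_in_mag)
qed (simp_all add: in_mag_fin fin_hom s.P_add s.P_smult)

section \<open>The image of iota is an ideal and equals the kernel of epsilon^*\<close>

text \<open>The image of iota inside the quotient, since \<open>hom iota_map\<close> fixes magma
  elements on these generators.\<close>

definition U :: "(gen_sym tree \<Rightarrow> 'k) set" where
  "U = t.P ` Collect (in_mag (uf_gens g n))"

lemma U_add: "v \<in> U \<Longrightarrow> w \<in> U \<Longrightarrow> v + w \<in> U"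
  and U_smult: "v \<in> U \<Longrightarrow> msmult c v \<in> U"
  and U_zero: "0 \<in> U"
  and U_qbr: "v \<in> U \<Longrightarrow> w \<in> U \<Longrightarrow> t.qbr v w \<in> U"
proof -
  have sub: "in_mag (uf_gens g n) u \<Longrightarrow> in_mag (tf_gens g (insert Star J)) u" for u :: "_ \<Rightarrow> 'k"
    using uf_gens_subset by (rule in_mag_mono[rotated])
  show "v \<in> U \<Longrightarrow> w \<in> U \<Longrightarrow> v + w \<in> U" "v \<in> U \<Longrightarrow> msmult c v \<in> U"
    by (auto simp: U_def simp flip: t.P_add t.P_smult)
  show "0 \<in> U" unfolding U_def by (rule image_eqI[of _ _ 0]) simp_all
  show "v \<in> U \<Longrightarrow> w \<in> U \<Longrightarrow> t.qbr v w \<in> U"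
    unfolding U_def by (auto simp: sub simp flip: t.P_br)
qed

lemma U_subspace: "module.subspace msmult U"
  by (intro br.subspaceI U_add U_smult U_zero)

lemma U_gen: "h \<in> uf_gens g n \<Longrightarrow> t.P (gen h) \<in> U"
  by (auto simp: U_def intro: in_mag_gen)

lemmas U_step = tfam.ideal_step[of Star J Zero U, OF refl Star_notin Zero_in U_subspace U_qbr
    U_gen[OF gens_simps(4)] U_gen[OF gens_simps(3)] U_gen[OF gens_simps(5)]]

text \<open>Two nested inductions, over the acting element and over the element of \<open>U\<close>;
  the case of two generators is \<open>ideal_step\<close>, and brackets are handled by the Leibniz
  rule.\<close>

lemma U_ideal:
  assumes "in_mag (tf_gens g (insert Star J)) v" and w: "w \<in> U"
  shows "t.qbr (t.P v) w \<in> U"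
  using assms
proof (induction arbitrary: w rule: in_mag_induct)
  case (gen h)
  then obtain u where u: "in_mag (uf_gens g n) u" and w: "w = t.P u" by (auto simp: U_def)
  have mem: "in_mag (uf_gens g n) u \<Longrightarrow> t.P u \<in> U" for u :: "_ \<Rightarrow> 'k" by (auto simp: U_def)
  have sub: "in_mag (uf_gens g n) u \<Longrightarrow> in_mag (tf_gens g (insert Star J)) u" for u :: "_ \<Rightarrow> 'k"
    using uf_gens_subset by (rule in_mag_mono[rotated])
  from u show ?case unfolding w
  proof (induction rule: in_mag_induct)
    case (gen y)
    from \<open>h \<in> _\<close> gen show ?case
      by (elim tf_gens_cases uf_gens_cases) (auto intro: U_step)
  next
    case (br u v)
    have "t.qbr (t.P (gen h)) (t.P (br u v)) =
      t.qbr (t.qbr (t.P (gen h)) (t.P u)) (t.P v) + t.qbr (t.P u) (t.qbr (t.P (gen h)) (t.P v))"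
      using br t.Q.B_leibniz[of "t.P (gen h)" "t.P u" "t.P v"] by (simp add: t.P_br sub)
    then show ?case using br by (simp add: U_add U_qbr mem)
  qed (simp_all add: t.P_add t.P_smult t.Q.B_bilinear U_add U_smult U_zero)
next
  case (br u v)
  have "t.qbr (t.P u) (t.qbr (t.P v) w) = t.qbr (t.qbr (t.P u) (t.P v)) w
      + t.qbr (t.P v) (t.qbr (t.P u) w)"
    by (rule t.Q.B_leibniz) simp_all
  then have "t.qbr (t.P (br u v)) w = t.qbr (t.P u) (t.qbr (t.P v) w) - t.qbr (t.P v) (t.qbr
      (t.P u) w)"
    using br by (simp add: t.P_br)
  then show ?case using br br.subspace_diff[OF U_subspace] by simp
qed (simp_all add: t.P_add t.P_smult t.Q.B_bilinear U_add U_smult U_zero)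

lemma mod_U:
  assumes "in_mag (tf_gens g (insert Star J)) v"
  shows "t.P v - t.P (hom split_map (hom eps_map v)) \<in> U"
  using assms
proof (induction rule: in_mag_induct)
  case (gen h)
  have t_U: "t.P (gen (T i Star)) \<in> U" if "i \<in> insert Star J" for i
    by (rule U_step(1)) (use that in auto)
  have t_U': "t.P (gen (T Star i)) \<in> U" if "i \<in> insert Star J" for i
    using t_U[OF that] tfam.t_sym[of Star i] that by simp
  have U_uminus: "v \<in> U \<Longrightarrow> - v \<in> U" for v using br.subspace_neg[OF U_subspace] .
  from gen show ?case
  proof (cases rule: tf_gens_cases)
    case (1 i j)
    show ?thesis
    proof (cases "i = Star \<or> j = Star")
      case True
      then show ?thesis using 1 t_U[of i] t_U'[of j] by (auto simp: eps_map_simps)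
    next
      case False
      then have ij: "i \<in> J" "j \<in> J" using 1 by auto
      have "t.P (gen (T i j)) - t.P (split_map (T i j)) = - ((if j
          = Zero then t.P (gen (T i Star)) else 0)
        + (if i = Zero then t.P (gen (T Star j)) else 0) + (if i = Zero \<and> j
            = Zero then t.P (gen (T Star Star)) else 0))"
        using P_split_T[OF ij] by (simp add: algebra_simps)
      also have "\<dots> \<in> U"
        using ij t_U t_U' by (intro U_uminus U_add) (auto simp: U_zero)
      finally show ?thesis using 1 False by (simp add: eps_map_simps)
    qed
  next
    case (2 c i)
    have "t.P (gen (Z c Star)) \<in> U" using 2 by (intro U_gen gens_simps)
    then show ?thesis using 2 U_uminus[of "t.P (gen (Z c Star))"]
      by (auto simp: eps_map_simps split_map_Z t.P_add U_zero)
  qed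
next
  case (br u v)
  let ?h = "\<lambda>v. hom split_map (hom eps_map v) :: _ \<Rightarrow> 'k"
  \<comment> \<open>One factor is exchanged at a time; both differences lie in \<open>U\<close> by
    induction, and \<open>U\<close> is an ideal.\<close>
  have "t.P (br u v) - t.P (?h (br u v)) =
    t.qbr (t.P (?h u)) (t.P v - t.P (?h v)) - t.qbr (t.P v) (t.P u - t.P (?h u))"
    using br t.Q.B_anti[of "t.P v" "t.P u"] t.Q.B_anti[of "t.P v" "t.P (?h u)"]
    by (simp add: in_mag_fin fin_hom hom_eps_in_mag hom_split_in_mag t.P_br t.Q.B_bilinear)
  moreover have "\<dots> \<in> U"
    using br by - (rule br.subspace_diff[OF U_subspace]; rule U_ideal;
        simp add: hom_split_in_mag hom_eps_in_mag)
  ultimately show ?case by simp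
next
  case (add u v)
  show ?case
    using add U_add[OF add(3,4)] by (simp add: in_mag_fin fin_hom t.P_add algebra_simps)
next
  case (smult c u)
  show ?case
    using smult U_smult[OF smult(2), of c]
    by (simp add: in_mag_fin fin_hom t.P_smult br.scale_right_diff_distrib)
qed (simp add: U_zero)

lemma kernel_eps:
  assumes v: "in_mag (tf_gens g (insert Star J)) v" and "hom eps_map v \<in> s.I"
  shows "\<exists>u. in_mag (uf_gens g n) u \<and> v - u \<in> t.I"
proof -
  have "t.P (hom split_map (hom eps_map v)) = 0"
    using split_ideal[OF assms(2)] by (rule t.P_ideal)
  then have "t.P v \<in> U" using mod_U[OF v] by simp
  then obtain u where u: "in_mag (uf_gens g n) u" "t.P v = t.P u" by (auto simp: U_def)
  moreover have "in_mag (tf_gens g (insert Star J)) u"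
    using u(1) uf_gens_subset by (rule in_mag_mono)
  ultimately show ?thesis using v t.P_eq_0_iff[of "v - u"] by (auto simp: t.P_diff)
qed

section \<open>The derivations of u by the remaining strands\<close>

definition ux :: "bool \<times> nat \<Rightarrow> gen_sym tree \<Rightarrow> 'k" where
  "ux c = u.P (gen (Z c Star))"

definition uc :: "gen_sym tree \<Rightarrow> 'k" where
  "uc = u.P (gen (T Star Star))"

text \<open>The value at the index 0 is forced by the last relation of the framed Lie algebra for the
  strand *.\<close>

definition ua :: "idx \<Rightarrow> gen_sym tree \<Rightarrow> 'k" where
  "ua i = (if i = Zero then msmult (of_nat g - 1) uc
      - (\<Sum>b\<in>{1..g}. u.qbr (ux (True, b)) (ux (False, b))) - (\<Sum>j\<in>J - {Zero}. u.P (gen (T j Star)))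
    else u.P (gen (T i Star)))"

lemma ua_gen: "i \<noteq> Zero \<Longrightarrow> ua i = u.P (gen (T i Star))"
  by (simp add: ua_def)

lemma uc_central: "u.qbr uc w = 0"
proof (rule u.qbr_central)
  fix h assume h: "h \<in> uf_gens g n"
  show "u.qbr uc (u.P (gen h)) = 0"
  proof (cases "h = T Star Star")
    case False
    then have "br (gen (T Star Star)) (gen h) \<in> (uf_rels g n :: (_ \<Rightarrow> 'k) set)"
      using h by (auto simp: uf_rels_def uf_gens_def)
    then have "u.P (br (gen (T Star Star)) (gen h)) = 0" by (intro u.P_ideal lie_ideal.rel)
    then show ?thesis using h by (simp add: uc_def u.P_br in_mag_gen gens_simps)
  qed (simp add: uc_def u.Q.B_self)
qed

text \<open>Every T-generator of u has second index \<open>Star\<close>, so only the first is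
  inspected. For \<open>i\<close> and \<open>j\<close> in \<open>J\<close> this gives 0 on
  \<open>T Star Star\<close>.\<close>

definition dt :: "idx \<Rightarrow> idx \<Rightarrow> gen_sym \<Rightarrow> gen_sym tree \<Rightarrow> 'k" where
  "dt i j h = (case h of T k _ \<Rightarrow>
    (if k = i then u.qbr (ua i) (ua j) else 0) + (if k = j then u.qbr (ua j) (ua i) else 0)
        | _ \<Rightarrow> 0)"

definition dx :: "bool \<times> nat \<Rightarrow> idx \<Rightarrow> gen_sym \<Rightarrow> gen_sym tree \<Rightarrow> 'k" where
  "dx c i h = (case h of T k _ \<Rightarrow> if k = i then u.qbr (ua i) (ux c) else 0
    | X b _ \<Rightarrow> msmult (omega c (True, b)) (ua i) | Y b _ \<Rightarrow> msmult (omega c (False, b)) (ua i))"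

text \<open>The only relators are [t_{**}, h]. Their image in the dual numbers has e-part
  [delta t_{**}, h] + [t_{**}, delta h], where the first term is zero by assumption and the second
  because t_{**} is central; the values on H are thus arbitrary.\<close>

lemma u_derivation:
  assumes "\<delta> (T Star Star) = 0"
  shows "u.derivation \<delta> \<in> u.Ders" "h \<in> uf_gens g n \<Longrightarrow> u.derivation \<delta> (u.P (gen h)) = \<delta> h"
proof -
  interpret L2: lie_on u.dsc UNIV u.dbr by (rule u.lie_on_dual_numbers)
  have *: "ev u.dsc u.dbr (\<lambda>x. (u.P (gen x), \<delta> x)) r = 0" if r: "r \<in> uf_rels g n" for r
  proof -
    obtain h where "r = br (gen (T Star Star)) (gen h)" using r unfolding uf_rels_def by blast
    then show ?thesis
      using uc_central assms by (simp add: u.dbr_def uc_def zero_prod_def)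
  qed
  show D: "u.derivation \<delta> \<in> u.Ders" by (rule u.derivation[OF *])
  then have "u.derivation \<delta> (u.P w) = u.derivation \<delta> w" for w by (simp add: u.Ders_def)
  then show "h \<in> uf_gens g n \<Longrightarrow> u.derivation \<delta> (u.P (gen h)) = \<delta> h"
    using u.derivation(2)[OF *] by simp
qed

abbreviation "ut i j \<equiv> u.derivation (dt i j)"
abbreviation "uz c i \<equiv> u.derivation (dx c i)"

text \<open>The value at \<open>ua Zero\<close> is computed, not prescribed. The derivation kills
  \<open>uc\<close> and all \<open>ux d\<close>, and the values at all \<open>ua k\<close> ought to
  sum to [a_i, a_j] + [a_j, a_i] = 0, so solving for the index \<open>Zero\<close> gives the same
  formula.\<close>

lemma ut:
  assumes i: "i \<in> J" and j: "j \<in> J"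
  shows "ut i j \<in> u.Ders" "d \<in> cols g \<Longrightarrow> ut i j (ux d) = 0" "ut i j uc = 0"
    "k \<in> J \<Longrightarrow> ut i j (ua k) = (if k = i then u.qbr (ua i) (ua j) else 0) + (if k
        = j then u.qbr (ua j) (ua i) else 0)"
proof -
  have ne: "i \<noteq> Star" "j \<noteq> Star" using i j Star_notin[of n] by metis+
  then have "dt i j (T Star Star) = 0" by (simp add: dt_def)
  note D = u_derivation[of "dt i j", OF this]
  show Der: "ut i j \<in> u.Ders" by (rule D)
  show x: "ut i j (ux d) = 0" if "d \<in> cols g" for d
    using that by (simp add: ux_def D(2) gens_simps) (simp add: dt_def Z_def)
  show c: "ut i j uc = 0"
    using ne by (simp add: uc_def D(2) gens_simps) (simp add: dt_def)
  have gen: "ut i j (u.P (gen (T k Star))) =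
      (if k = i then u.qbr (ua i) (ua j) else 0) + (if k = j then u.qbr (ua j) (ua i) else 0)"
    if "k \<in> J" "k \<noteq> Zero" for k
    using that by (simp add: D(2) gens_simps) (simp add: dt_def)
  have "ut i j (ua Zero) = - (\<Sum>k\<in>J - {Zero}.
      (if k = i then u.qbr (ua i) (ua j) else 0) + (if k = j then u.qbr (ua j) (ua i) else 0))"
    using gen by (simp add: ua_def u.ext.Der_linear[OF Der] u.ext.Der_sum[OF Der] u.ext.Der_B[OF
        Der]
        c x cols_def)
  also have "\<dots> = - ((if i \<noteq> Zero then u.qbr (ua i) (ua j) else 0)
      + (if j \<noteq> Zero then u.qbr (ua j) (ua i) else 0))"
    using i j by (simp add: sum.distrib sum.delta)
  also have "\<dots> = (if Zero = i then u.qbr (ua i) (ua j) else 0) + (if Zero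
      = j then u.qbr (ua j) (ua i) else 0)"
    using u.Q.B_anti[of "ua i" "ua j"] by (auto simp: u.Q.B_self)
  finally have zero: "ut i j (ua Zero) = \<dots>" .
  show "ut i j (ua k) = (if k = i then u.qbr (ua i) (ua j) else 0) + (if k
      = j then u.qbr (ua j) (ua i) else 0)"
    if "k \<in> J" for k
  proof (cases "k = Zero")
    case True then show ?thesis using zero by simp
  next
    case False then show ?thesis using gen[OF that] by (simp add: ua_def)
  qed
qed

text \<open>Again the value at \<open>ua Zero\<close> is computed: the sum of the [x, y] is sent to
  -[a_i, x_c], which must cancel the total over all \<open>ua k\<close>, so the formula persists for
  the index \<open>Zero\<close>.\<close>

lemma uz:
  assumes c: "c \<in> cols g" and i: "i \<in> J"
  shows "uz c i \<in> u.Ders" "d \<in> cols g \<Longrightarrow> uz c i (ux d) = msmult (omega c d) (ua i)" "uz c i uc = 0"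
    "k \<in> J \<Longrightarrow> uz c i (ua k) = (if k = i then u.qbr (ua i) (ux c) else 0)"
proof -
  have ne: "i \<noteq> Star" "Star \<noteq> i" using i Star_notin[of n] by metis+
  then have "dx c i (T Star Star) = 0" by (simp add: dx_def)
  note D = u_derivation[of "dx c i", OF this]
  show Der: "uz c i \<in> u.Ders" by (rule D)
  show x: "uz c i (ux d) = msmult (omega c d) (ua i)" if "d \<in> cols g" for d
  proof -
    have "(True, snd d) = d" if "fst d" using that by (cases d) simp
    moreover have "(False, snd d) = d" if "\<not> fst d" using that by (cases d) simp
    ultimately show ?thesis
      using that by (simp add: ux_def D(2) gens_simps) (simp add: dx_def Z_def)
  qed
  show uc: "uz c i uc = 0"
    using ne by (simp add: uc_def D(2) gens_simps) (simp add: dx_def)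
  have gen: "uz c i (u.P (gen (T k Star))) = (if k = i then u.qbr (ua i) (ux c) else 0)"
    if "k \<in> J" "k \<noteq> Zero" for k
    using that by (simp add: D(2) gens_simps) (simp add: dx_def)
  obtain p e where pe: "c = (p, e)" and e: "e \<in> {1..g}" using c by (auto simp: cols_def)
  \<comment> \<open>Only the pair with the same number \<open>e\<close> as \<open>c\<close>
    contributes: one of its two members is sent to a multiple of \<open>ua i\<close>, with the sign
    from \<open>omega\<close>.\<close>
  have "(\<Sum>b\<in>{1..g}. uz c i (u.qbr (ux (True, b)) (ux (False, b)))) =
      (\<Sum>b\<in>{1..g}. if b = e then - u.qbr (ua i) (ux c) else 0)"
  proof (intro sum.cong refl)
    fix b assume b: "b \<in> {1..g}"
    then have b': "(True, b) \<in> cols g" "(False, b) \<in> cols g" by (auto simp: cols_def)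
    then have "uz c i (u.qbr (ux (True, b)) (ux (False, b))) =
      msmult (omega c (True, b)) (u.qbr (ua i) (ux (False, b))) +
      msmult (omega c (False, b)) (u.qbr (ux (True, b)) (ua i))"
      by (simp add: u.ext.Der_B[OF Der] x u.Q.B_bilinear)
    also have "\<dots> = (if b = e then - u.qbr (ua i) (ux c) else 0)"
      using u.Q.B_anti[of "ux (True, e)" "ua i"] by (cases p) (auto simp: pe omega_def)
    finally show "uz c i (u.qbr (ux (True, b)) (ux (False, b))) =
      (if b = e then - u.qbr (ua i) (ux c) else 0)" .
  qed
  also have "\<dots> = - u.qbr (ua i) (ux c)" using e by simp
  finally have S: "(\<Sum>b\<in>{1..g}. uz c i (u.qbr (ux (True, b)) (ux (False, b))))
      = - u.qbr (ua i) (ux c)" .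
  have "uz c i (ua Zero) = - (\<Sum>b\<in>{1..g}. uz c i (u.qbr (ux (True, b)) (ux (False, b))))
      - (\<Sum>k\<in>J - {Zero}. if k = i then u.qbr (ua i) (ux c) else 0)"
    using gen by (simp add: ua_def u.ext.Der_linear[OF Der] u.ext.Der_sum[OF Der] uc)
  also have "\<dots> = u.qbr (ua i) (ux c) - (if i \<noteq> Zero then u.qbr (ua i) (ux c) else 0)"
    unfolding S using i by simp
  finally have zero: "uz c i (ua Zero) = (if Zero = i then u.qbr (ua i) (ux c) else 0)" by auto
  show "uz c i (ua k) = (if k = i then u.qbr (ua i) (ux c) else 0)" if "k \<in> J" for k
  proof (cases "k = Zero")
    case True then show ?thesis using zero by simp
  next
    case False then show ?thesis using gen[OF that] by (simp add: ua_def)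
  qed
qed

sublocale act: strand_action msmult u.qbr u.Ders g J Zero Star ua ux uc ut uz
proof
  show "D = 0"
    if D: "D \<in> u.Ders" and "\<And>c. c \<in> cols g \<Longrightarrow> D (ux c) = 0" "\<And>k. k \<in> J \<Longrightarrow> D (ua k) = 0" "D uc
        = 0" for D
  proof (rule u.Ders_ext[OF D])
    fix h assume h: "h \<in> uf_gens g n"
    have "D (gen h) = D (u.P (gen h))" using D by (simp add: u.Ders_def)
    also have "\<dots> = 0"
      using h
    proof (cases rule: uf_gens_cases)
      case (1 j)
      then show ?thesis using that(3)[of j] by (simp add: ua_gen)
    qed (use that in \<open>simp_all add: ux_def uc_def\<close>)
    finally show "D (gen h) = 0" .
  qed
  have "sum ua J = ua Zero + (\<Sum>j\<in>J - {Zero}. ua j)" by (rule sum.remove) simp_all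
  also have "(\<Sum>j\<in>J - {Zero}. ua j) = (\<Sum>j\<in>J - {Zero}. u.P (gen (T j Star)))"
    by (intro sum.cong refl) (simp add: ua_def)
  finally show "(\<Sum>b\<in>{1..g}. u.qbr (ux (True, b)) (ux (False, b))) + sum ua J
      = msmult (of_nat g - 1) uc"
    by (simp add: ua_def)
qed (simp_all add: uc_central ut uz)

section \<open>The homomorphism to the semidirect product and the injectivity of iota\<close>

text \<open>The value 0 off the generators keeps every symbol inside \<open>u.ext.pS\<close>, as
  \<open>ev_lie_ideal\<close> demands.\<close>

definition model :: "gen_sym \<Rightarrow> (gen_sym tree \<Rightarrow> 'k) \<times> ((gen_sym tree \<Rightarrow> 'k) \<Rightarrow> (gen_sym tree \<Rightarrow>
    'k))" where
  "model h = (if h \<in> tf_gens g (insert Star J) then case h of T i j \<Rightarrow> act.ft i j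
    | X b i \<Rightarrow> act.fx (True, b) i | Y b i \<Rightarrow> act.fx (False, b) i else 0)"

lemma model_T: "i \<in> insert Star J \<Longrightarrow> j \<in> insert Star J \<Longrightarrow> model (T i j) = act.ft i j"
  by (simp add: model_def gens_simps)

lemma model_Z: "c \<in> cols g \<Longrightarrow> i \<in> insert Star J \<Longrightarrow> model (Z c i) = act.fx c i"
  by (cases c) (auto simp: model_def gens_simps Z_def tf_gens_def cols_def)

lemma model_family:
  "tf_family u.ext.psc u.ext.pS u.ext.pbr g (insert Star J) (\<lambda>i j. model (T i j)) (\<lambda>c i. model
      (Z c i))"
  using act.tf_family_pairs by (rule tf_family_cong) (simp_all add: model_T model_Z)

lemma model_closed: "model h \<in> u.ext.pS"
proof (cases "h \<in> tf_gens g (insert Star J)")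
  case True
  interpret tf_family u.ext.psc u.ext.pS u.ext.pbr g "insert Star J" act.ft act.fx
    by (rule act.tf_family_pairs)
  from True show ?thesis
    by (cases rule: tf_gens_cases) (simp_all add: model_T model_Z)
qed (simp add: model_def)

text \<open>Both sides respect sums, scalars and brackets and agree on the generators. As
  \<open>inn\<close> has the identity as first component, elements of u can be read off from their
  image.\<close>

lemma ev_model_uf:
  assumes "in_mag (uf_gens g n) u"
  shows "ev u.ext.psc u.ext.pbr model u = u.ext.inn (u.P u)"
  using assms
proof (induction rule: in_mag_induct)
  case (gen h)
  then show ?case
    by (cases rule: uf_gens_cases)
      (auto simp: model_T model_Z act.ft_def act.fx_def ua_gen simp flip: ux_def uc_def)
next
  case (br u v)
  then show ?case
    by (simp add: in_mag_fin model_closed u.ext.pbr_inn_right u.P_br)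
qed (simp_all add: in_mag_fin u.ext.inn_linear u.P_add u.P_smult)

lemma iota_inj:
  assumes u: "in_mag (uf_gens g n) u" and "u \<in> t.I"
  shows "u \<in> u.I"
proof -
  have "fin u \<and> ev u.ext.psc u.ext.pbr model u = 0"
    using assms(2)
    by (rule u.ext.pair.ev_lie_ideal[rotated 2])
      (auto simp: model_closed intro!: u.ext.pair.ev_tf_rels[OF _ model_family] in_mag_fin[OF
          tf_rels_in_mag])
  then have "u.ext.inn (u.P u) = 0" using ev_model_uf[OF u] by simp
  then have "fst (u.ext.inn (u.P u)) = 0" by simp
  then show ?thesis using u.P_eq_0_iff[OF u] by simp
qed

end

theorem theorem8p12:
  fixes g n :: nat
  defines "Gu \<equiv> uf_gens g n"
      and "Iu \<equiv> lie_ideal (uf_gens g n) (uf_rels g n :: (gen_sym tree \<Rightarrow> 'k::field_char_0) set)"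
      and "Gt \<equiv> tf_gens g (idx_n_star_0 n)"
      and "It \<equiv> lie_ideal (tf_gens g (idx_n_star_0 n))
                   (tf_rels g (idx_n_star_0 n) :: (gen_sym tree \<Rightarrow> 'k) set)"
      and "Gs \<equiv> tf_gens g (idx_n_0 n)"
      and "Is \<equiv> lie_ideal (tf_gens g (idx_n_0 n)) (tf_rels g (idx_n_0 n) :: (gen_sym tree \<Rightarrow> 'k) set)"
  shows
    \<comment> \<open>iota, epsilon^* and the splitting are well-defined Lie algebra maps\<close>
    "(\<forall>u. in_mag Gu u \<longrightarrow> in_mag Gt (hom iota_map u) \<and> (u \<in> Iu \<longrightarrow> hom iota_map u \<in> It))
   \<and> (\<forall>v. in_mag Gt v \<longrightarrow> in_mag Gs (hom eps_map v) \<and> (v \<in> It \<longrightarrow> hom eps_map v \<in> Is))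
   \<and> (\<forall>w. in_mag Gs w \<longrightarrow> in_mag Gt (hom split_map w) \<and> (w \<in> Is \<longrightarrow> hom split_map w \<in> It))
    \<comment> \<open>iota is injective\<close>
   \<and> (\<forall>u. in_mag Gu u \<longrightarrow> hom iota_map u \<in> It \<longrightarrow> u \<in> Iu)
    \<comment> \<open>image of iota = kernel of epsilon^*\<close>
   \<and> (\<forall>u. in_mag Gu u \<longrightarrow> hom eps_map (hom iota_map u) \<in> Is)
   \<and> (\<forall>v. in_mag Gt v \<longrightarrow> hom eps_map v \<in> Is \<longrightarrow>
          (\<exists>u. in_mag Gu u \<and> msub v (hom iota_map u) \<in> It))
    \<comment> \<open>the splitting is a section of epsilon^* (in particular epsilon^* is surjective)\<close>
   \<and> (\<forall>w. in_mag Gs w \<longrightarrow> msub (hom eps_map (hom split_map w)) w \<in> Is)"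
proof -
  interpret exact_sequence g n "TYPE('k)" .
  have Gt: "Gt = tf_gens g (insert Star J)" and It: "It = t.I"
    by (simp_all add: Gt_def It_def idx_n_star_0_eq)
  have defs: "Gu = uf_gens g n" "Iu = u.I" "Gs = tf_gens g J" "Is = s.I"
    by (simp_all add: Gu_def Iu_def Gs_def Is_def)
  have sub: "in_mag (tf_gens g (insert Star J)) u" if "in_mag (uf_gens g n) u" for u :: "_ \<Rightarrow> 'k"
    using that uf_gens_subset by (rule in_mag_mono)
  have zero: "0 \<in> s.I" using lie_ideal.zero[of "tf_gens g J" "tf_rels g J :: (_ \<Rightarrow> 'k) set"] by simp
  have section_eps: "hom eps_map (hom split_map w) - w \<in> s.I" if
      "in_mag (tf_gens g J) w" for w :: "_ \<Rightarrow> 'k"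
    using s.P_eq_0_iff[of "hom eps_map (hom split_map w) - w"] eps_split[OF that] that
    by (simp add: s.P_diff hom_eps_in_mag hom_split_in_mag)
  show ?thesis
    unfolding Gt It defs mag_ops
  proof (intro conjI allI impI)
    fix u :: "gen_sym tree \<Rightarrow> 'k" assume u: "in_mag (uf_gens g n) u"
    show "in_mag (tf_gens g (insert Star J)) (hom iota_map u)" using u by (simp add: hom_iota sub)
    show "hom iota_map u \<in> t.I \<Longrightarrow> u \<in> u.I" using u by (simp add: hom_iota iota_inj)
    show "hom eps_map (hom iota_map u) \<in> s.I" using u zero by (simp add: hom_iota eps_iota)
  next
    fix v :: "gen_sym tree \<Rightarrow> 'k"
    assume "in_mag (tf_gens g (insert Star J)) v" "hom eps_map v \<in> s.I"
    from kernel_eps[OF this] show "\<exists>u. in_mag (uf_gens g n) u \<and> v - hom iota_map u \<in> t.I"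
      by (metis hom_iota)
  qed (simp_all add: iota_ideal eps_ideal split_ideal hom_eps_in_mag hom_split_in_mag section_eps)
qed

end
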